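(* For every Bruhat interval $[u,v]\subset S_n$ with $u<v$ there is a proper subset $I_{\mathrm{st}}\subsetneq[u,v]$ which is a strong hypercube decomposition of $[u,v]$ and satisfies $\widetilde{R}_{u,v}(q)=\widetilde{H}_{u,v,I_{\mathrm{st}}}(q)$.
   Context: $S_n$ is the symmetric group with simple reflections $s_i=(i\ i{+}1)$, length $\ell$, $\ell(u,v)=\ell(v)-\ell(u)$, and $T$ its transpositions. The Bruhat graph $\Gamma$ has vertex set $S_n$ and edges $w\to tw$ whenever $t\in T$, $\ell(w)<\ell(tw)$; Bruhat order is reachability; $\Gamma(u,v)$ is the induced subgraph on $[u,v]$. A diamond is a subgraph of $\Gamma$ with four distinct vertices $x_1,\dots,x_4$ and edges $x_1\to x_2\to x_4$, $x_1\to x_3\to x_4$; $X\subset[u,v]$ is diamond-closed in $[u,v]$ if it contains the fourth vertex of every diamond in $[u,v]$ of which it contains three vertices. $R$-polynomials: $R_{u,v}=0$ if $u\not\le v$, $R_{v,v}=1$, $R_{u,v}=R_{us,vs}$ if $s\in\mathrm{Des}(u)\cap\mathrm{Des}(v)$, $R_{u,v}=qR_{us,vs}+(q-1)R_{u,vs}$ if $s\in\mathrm{Des}(v)\setminus\mathrm{Des}(u)$, with $\mathrm{Des}(w)=\{s_i:ws_i<w\}$; $\widetilde{R}_{u,v}\in\mathbb{N}[q]$ is the unique polynomial with $R_{u,v}(q)=q^{\ell(u,v)/2}\widetilde{R}_{u,v}(q^{1/2}-q^{-1/2})$. For an order ideal $I\subset[u,v]$ and $x\in I$, $\mathcal{Y}_x=\{y\in[u,v]\setminus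 I:x\to y\}$, $\mathcal{A}_x$ the set of Bruhat antichains in $\mathcal{Y}_x$, with $Y_1\to Y_2$ iff $Y_1\subset Y_2$, $|Y_2\setminus Y_1|=1$. A strong hypercube cluster at $x$ is $\theta_x:\mathcal{A}_x\to[u,v]$ with (HC1) $\theta_x(\varnothing)=x$; (HC2) $\theta_x(\{y\})=y$; (HC3) $Y_1\to Y_2$ implies $\theta_x(Y_1)\to\theta_x(Y_2)$ in $\Gamma$; (HC4) if $|Y|=|Y'|=|Y\cap Y'|+1$ and $\theta_x(Y\cap Y'),\theta_x(Y),\theta_x(Y'),w$ form a diamond in $\Gamma(u,v)$ with top $w$, then $Y\cup Y'$ is an antichain and $\theta_x(Y\cup Y')=w$. A strong hypercube decomposition of $[u,v]$ is an order ideal $I=[u,z]$ ($z\in[u,v]$), diamond-closed in $[u,v]$, such that every $x\in I$ has a strong hypercube cluster relative to $I$. $\widetilde{H}_{u,v,I}(q)=\sum_{x\in I}\sum_{Y\in\mathcal{A}_x,\ \theta_x(Y)=v}q^{|Y|}\widetilde{R}_{u,x}(q)$. *)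

theory Defs
  imports Complex_Main "HOL-Combinatorics.Permutations" "HOL-Computational_Algebra.Polynomial"
begin

type_synonym perm = "nat \<Rightarrow> nat"

text \<open>The symmetric group S_n: permutations of {1..n} (fixing every other natural number).
  Products are function composition: (t w)(k) = t (w k).\<close>
definition Sym :: "nat \<Rightarrow> perm set" where
  "Sym n = {w. w permutes {1..n}}"

definition len :: "nat \<Rightarrow> perm \<Rightarrow> nat" where
  "len n w = card {(i, j). i \<in> {1..n} \<and> j \<in> {1..n} \<and> i < j \<and> w j < w i}"

definition transps :: "nat \<Rightarrow> perm set" where
  "transps n = {Transposition.transpose i j | i j. i \<in> {1..n} \<and> j \<in> {1..n} \<and> i \<noteq> j}"

definition sref :: "nat \<Rightarrow> perm" where
  "sref i = Transposition.transpose i (Suc i)"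

definition bedge :: "nat \<Rightarrow> perm \<Rightarrow> perm \<Rightarrow> bool" where
  "bedge n w w' \<longleftrightarrow> w \<in> Sym n \<and> (\<exists>t \<in> transps n. w' = t \<circ> w) \<and> len n w < len n w'"

definition bruhat_le :: "nat \<Rightarrow> perm \<Rightarrow> perm \<Rightarrow> bool" where
  "bruhat_le n u v \<longleftrightarrow> u \<in> Sym n \<and> (bedge n)\<^sup>*\<^sup>* u v"

definition interval :: "nat \<Rightarrow> perm \<Rightarrow> perm \<Rightarrow> perm set" where
  "interval n u v = {w \<in> Sym n. bruhat_le n u w \<and> bruhat_le n w v}"

definition is_desc :: "nat \<Rightarrow> perm \<Rightarrow> nat \<Rightarrow> bool" where
  "is_desc n w i \<longleftrightarrow> i \<in> {1..<n} \<and> len n (w \<circ> sref i) < len n w"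

lemma is_desc_Least: "\<exists>i. is_desc n v i \<Longrightarrow> len n (v \<circ> sref (LEAST i. is_desc n v i)) < len n v"
  by (metis (mono_tags) LeastI_ex is_desc_def)

text \<open>R-polynomials, via the standard recursion, always using the smallest descent of v
  (the recursion is independent of this choice).\<close>
function Rpoly :: "nat \<Rightarrow> perm \<Rightarrow> perm \<Rightarrow> int poly" where
  "Rpoly n u v =
    (if \<not> bruhat_le n u v then 0
     else if u = v then 1
     else if \<not> (\<exists>i. is_desc n v i) then 0
     else (let i = (LEAST i. is_desc n v i) in
           if is_desc n u i then Rpoly n (u \<circ> sref i) (v \<circ> sref i)
           else [:0, 1:] * Rpoly n (u \<circ> sref i) (v \<circ> sref i)
                + [:-1, 1:] * Rpoly n u (v \<circ> sref i)))"
  by pat_completeness auto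
termination
  apply (relation "measure (\<lambda>(n, u, v). len n v)")
   apply simp
  by (auto simp: Let_def is_desc_Least)

definition Rtilde :: "nat \<Rightarrow> perm \<Rightarrow> perm \<Rightarrow> int poly" where
  "Rtilde n u v = (THE p :: int poly. \<forall>q :: real. q > 0 \<longrightarrow>
      poly (map_poly real_of_int (Rpoly n u v)) q
        = q powr (real (len n v - len n u) / 2)
          * poly (map_poly real_of_int p) (sqrt q - 1 / sqrt q))"

definition diamond :: "nat \<Rightarrow> perm \<Rightarrow> perm \<Rightarrow> perm \<Rightarrow> perm \<Rightarrow> perm \<Rightarrow> perm \<Rightarrow> bool" where
  "diamond n u v x1 x2 x3 x4 \<longleftrightarrow> distinct [x1, x2, x3, x4]
     \<and> {x1, x2, x3, x4} \<subseteq> interval n u v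
     \<and> bedge n x1 x2 \<and> bedge n x2 x4 \<and> bedge n x1 x3 \<and> bedge n x3 x4"

definition diamond_closed :: "nat \<Rightarrow> perm \<Rightarrow> perm \<Rightarrow> perm set \<Rightarrow> bool" where
  "diamond_closed n u v X \<longleftrightarrow> X \<subseteq> interval n u v \<and>
     (\<forall>x1 x2 x3 x4. diamond n u v x1 x2 x3 x4 \<longrightarrow> card ({x1, x2, x3, x4} \<inter> X) \<ge> 3
        \<longrightarrow> {x1, x2, x3, x4} \<subseteq> X)"

definition Ycal :: "nat \<Rightarrow> perm \<Rightarrow> perm \<Rightarrow> perm set \<Rightarrow> perm \<Rightarrow> perm set" where
  "Ycal n u v I x = {y \<in> interval n u v - I. bedge n x y}"

definition bantichain :: "nat \<Rightarrow> perm set \<Rightarrow> bool" where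
  "bantichain n A \<longleftrightarrow> (\<forall>a \<in> A. \<forall>b \<in> A. a \<noteq> b \<longrightarrow> \<not> bruhat_le n a b)"

definition Acal :: "nat \<Rightarrow> perm \<Rightarrow> perm \<Rightarrow> perm set \<Rightarrow> perm \<Rightarrow> perm set set" where
  "Acal n u v I x = {Y. Y \<subseteq> Ycal n u v I x \<and> bantichain n Y}"

definition strong_cluster ::
  "nat \<Rightarrow> perm \<Rightarrow> perm \<Rightarrow> perm set \<Rightarrow> perm \<Rightarrow> (perm set \<Rightarrow> perm) \<Rightarrow> bool" where
  "strong_cluster n u v I x \<theta> \<longleftrightarrow>
     (\<forall>Y \<in> Acal n u v I x. \<theta> Y \<in> interval n u v)
   \<and> \<theta> {} = x
   \<and> (\<forall>y \<in> Ycal n u v I x. \<theta> {y} = y)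
   \<and> (\<forall>Y1 \<in> Acal n u v I x. \<forall>Y2 \<in> Acal n u v I x.
        Y1 \<subseteq> Y2 \<and> card (Y2 - Y1) = 1 \<longrightarrow> bedge n (\<theta> Y1) (\<theta> Y2))
   \<and> (\<forall>Y \<in> Acal n u v I x. \<forall>Y' \<in> Acal n u v I x. \<forall>w.
        card Y = card (Y \<inter> Y') + 1 \<and> card Y' = card (Y \<inter> Y') + 1
        \<and> diamond n u v (\<theta> (Y \<inter> Y')) (\<theta> Y) (\<theta> Y') w
        \<longrightarrow> bantichain n (Y \<union> Y') \<and> \<theta> (Y \<union> Y') = w)"

definition strong_hcd ::
  "nat \<Rightarrow> perm \<Rightarrow> perm \<Rightarrow> perm set \<Rightarrow> (perm \<Rightarrow> perm set \<Rightarrow> perm) \<Rightarrow> bool" where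
  "strong_hcd n u v I \<Theta> \<longleftrightarrow>
     (\<exists>z \<in> interval n u v. I = interval n u z)
   \<and> diamond_closed n u v I
   \<and> (\<forall>x \<in> I. strong_cluster n u v I x (\<Theta> x))"

definition Htilde ::
  "nat \<Rightarrow> perm \<Rightarrow> perm \<Rightarrow> perm set \<Rightarrow> (perm \<Rightarrow> perm set \<Rightarrow> perm) \<Rightarrow> int poly" where
  "Htilde n u v I \<Theta> = (\<Sum>x \<in> I. \<Sum>Y \<in> {Y \<in> Acal n u v I x. \<Theta> x Y = v}.
      monom 1 (card Y) * Rtilde n u x)"

end

theory Submission
  imports Defs
begin

text \<open>
  Let \<open>m\<close> be the last position where \<open>u\<close> and \<open>v\<close> differ; the ideal consists of the \<open>x\<close> in \<open>[u, v]\<close> with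
  \<open>x m = u m\<close>. An edge from such an \<open>x\<close> out of the ideal is \<open>x \<rightarrow> x (a m)\<close> with \<open>a < m\<close> and \<open>x a < x m\<close>,
  and these neighbours form an antichain for \<open>a\<^sub>1 < \<dots> < a\<^sub>k\<close> iff \<open>x a\<^sub>1 > \<dots> > x a\<^sub>k\<close>. The cluster sends
  this antichain to \<open>x (a\<^sub>1 m) \<dots> (a\<^sub>k m)\<close>, which is its join in Bruhat order, as one reads off from the
  rank functions \<open>#{i \<le> p. w i \<ge> q}\<close>. These characterise Bruhat order, and they also give the maximum
  of the ideal.

  The polynomials \<open>Rtilde u v\<close>, as functions of \<open>u\<close>, arise from each other by operators attached to the
  right descents of \<open>v\<close>; the braid relations make the recursion valid for every descent. The
  identity with \<open>Htilde\<close> follows by induction on the length of \<open>v\<close>: descents among the positions before \<open>m\<close>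
  act compatibly on both sides, and if there are none then \<open>v\<close> increases before \<open>m\<close> and only one
  cluster contributes.
\<close>

text \<open>Edges multiply by a transposition on the left, but exchanging two values of
  \<open>w\<close> is the same as exchanging their positions, and positions are the side on which
  descents, \<open>Dop\<close> and cosets act. Beyond the last differing position every element of
  the interval agrees with \<open>u\<close>; this freezing makes the ideal part of a coset of the
  group that permutes the positions before \<open>m\<close>. The defining recursion of
  \<open>Rpoly\<close> follows the least descent of \<open>v\<close>, whereas the induction needs
  descents at prescribed positions up to \<open>m\<close>; hence the detour through operators.
  Moreover the induction replaces \<open>u\<close> by \<open>u \<circ> sref i\<close>, which may
  cease to lie below \<open>v\<close>. The identity is therefore proved for all \<open>u\<close>
  that agree with \<open>v\<close> beyond \<open>m\<close>, with a sum over the whole coset, and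
  only at the end restricted to the ideal. Its mechanism is an adjunction: the operator acting on
  \<open>u\<close> passes to the summation variable \<open>x\<close>, and from there to
  \<open>v\<close> inside the cluster count \<open>cc\<close>.\<close>

abbreviation tp :: "nat \<Rightarrow> nat \<Rightarrow> perm" where
  "tp a b \<equiv> Transposition.transpose a b"

definition X :: "int poly" where
  "X = [:0, 1:]"

section \<open>Length and the edges of the Bruhat graph\<close>

lemma Sym_inj: "w \<in> Sym n \<Longrightarrow> w a = w b \<longleftrightarrow> a = b"
  by (metis Sym_def mem_Collect_eq permutes_inj injD)

lemma Sym_out: "w \<in> Sym n \<Longrightarrow> k \<notin> {1..n} \<Longrightarrow> w k = k"
  by (simp add: Sym_def permutes_def)

lemma Sym_in: "w \<in> Sym n \<Longrightarrow> w k \<in> {1..n} \<longleftrightarrow> k \<in> {1..n}"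
  by (simp only: Sym_def mem_Collect_eq permutes_in_image)

lemma Sym_comp_tp:
  assumes "w \<in> Sym n" "a \<in> {1..n}" "b \<in> {1..n}"
  shows "w \<circ> tp a b \<in> Sym n"
  using assms unfolding Sym_def by (auto intro!: permutes_compose permutes_swap_id)

lemma finite_Sym: "finite (Sym n)"
  unfolding Sym_def by (rule finite_permutations) simp

lemma comp_tp_tp [simp]: "w \<circ> tp a b \<circ> tp a b = w"
  by (simp add: comp_assoc)

lemma comp_tp_eq_iff: "w \<circ> tp a b = w' \<circ> tp a b \<longleftrightarrow> w = w'"
  by (metis comp_tp_tp)

lemma tp_comp_Sym:
  assumes "w \<in> Sym n"
  shows "tp (w a) (w b) \<circ> w = w \<circ> tp a b"
  by (rule ext) (auto simp: transpose_def Sym_inj[OF assms])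

definition Inv :: "nat \<Rightarrow> perm \<Rightarrow> (nat \<times> nat) set" where
  "Inv n w = {(i, j). i \<in> {1..n} \<and> j \<in> {1..n} \<and> i < j \<and> w j < w i}"

lemma len_eq_card_Inv: "len n w = card (Inv n w)"
  by (simp add: len_def Inv_def)

lemma finite_Inv: "finite (Inv n w)"
  by (rule finite_subset[of _ "{1..n} \<times> {1..n}"]) (auto simp: Inv_def)

text \<open>The map \<open>?f\<close> carries an inversion along the exchange when this keeps the
  pair in order, and otherwise leaves it alone; it is injective and misses the new inversion
  \<open>(a, b)\<close>.\<close>

lemma len_less_comp_tp:
  assumes ab: "a \<in> {1..n}" "b \<in> {1..n}" "a < b" and w: "w a < w b"
  shows "len n w < len n (w \<circ> tp a b)"
proof -
  let ?t = "tp a b"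
  let ?f = "\<lambda>(i, j). if ?t i < ?t j then (?t i, ?t j) else (i, j)"
  have "?f ` Inv n w \<subseteq> Inv n (w \<circ> ?t) - {(a, b)}"
  proof (rule image_subsetI)
    fix z assume "z \<in> Inv n w"
    then show "?f z \<in> Inv n (w \<circ> ?t) - {(a, b)}"
      using ab w by (cases z) (auto simp: Inv_def transpose_def split: if_splits)
  qed
  moreover have "inj_on ?f (Inv n w)"
    by (rule inj_onI) (auto split: if_splits simp: Inv_def dest: transpose_eq_imp_eq)
  ultimately have le: "card (Inv n w) \<le> card (Inv n (w \<circ> ?t) - {(a, b)})"
    by (intro card_inj_on_le[of ?f] finite_Diff finite_Inv)
  have "(a, b) \<in> Inv n (w \<circ> ?t)"
    using ab w by (auto simp: Inv_def)
  then have "card (Inv n (w \<circ> ?t) - {(a, b)}) < card (Inv n (w \<circ> ?t))"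
    by (intro card_Diff1_less finite_Inv)
  with le show ?thesis by (simp add: len_eq_card_Inv)
qed

lemma len_less_comp_tp_iff:
  assumes "w \<in> Sym n" "a \<in> {1..n}" "b \<in> {1..n}" "a < b"
  shows "len n w < len n (w \<circ> tp a b) \<longleftrightarrow> w a < w b"
proof
  assume less: "len n w < len n (w \<circ> tp a b)"
  show "w a < w b"
  proof (rule ccontr)
    assume "\<not> w a < w b"
    then have "w b < w a" using Sym_inj[OF assms(1), of a b] assms(4) by auto
    then show False
      using len_less_comp_tp[of a n b "w \<circ> tp a b"] assms less by auto
  qed
qed (use assms in \<open>auto intro: len_less_comp_tp\<close>)

text \<open>A transposition of values acts on \<open>w\<close> as the transposition of the positions
  holding them. In this form, used throughout, an edge exchanges an ascending pair of
  entries.\<close>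

lemma bedge_iff:
  "bedge n w w' \<longleftrightarrow> w \<in> Sym n \<and>
     (\<exists>a b. a \<in> {1..n} \<and> b \<in> {1..n} \<and> a < b \<and> w a < w b \<and> w' = w \<circ> tp a b)"
proof
  assume e: "bedge n w w'"
  then obtain i j where w: "w \<in> Sym n" and ij: "i \<in> {1..n}" "j \<in> {1..n}" "i \<noteq> j"
    "w' = tp i j \<circ> w" and less: "len n w < len n w'"
    by (auto simp: bedge_def transps_def)
  have "w ` {1..n} = {1..n}" using w by (simp add: Sym_def permutes_image)
  with ij obtain a b where ab: "a \<in> {1..n}" "b \<in> {1..n}" "w a = i" "w b = j"
    by (metis imageE)
  then have eq: "w' = w \<circ> tp a b" using ij tp_comp_Sym[OF w] by metis
  consider "a < b" | "b < a" using ab ij by fastforce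
  then show "w \<in> Sym n \<and>
     (\<exists>a b. a \<in> {1..n} \<and> b \<in> {1..n} \<and> a < b \<and> w a < w b \<and> w' = w \<circ> tp a b)"
  proof cases
    case 1
    then show ?thesis using w ab eq less len_less_comp_tp_iff by blast
  next
    case 2
    then show ?thesis using w ab eq less len_less_comp_tp_iff[OF w ab(2,1)]
      by (metis transpose_commute)
  qed
next
  assume "w \<in> Sym n \<and>
     (\<exists>a b. a \<in> {1..n} \<and> b \<in> {1..n} \<and> a < b \<and> w a < w b \<and> w' = w \<circ> tp a b)"
  then obtain a b where h: "w \<in> Sym n" "a \<in> {1..n}" "b \<in> {1..n}" "a < b" "w a < w b"
    "w' = w \<circ> tp a b" by blast
  have "tp (w a) (w b) \<in> transps n"
  proof -
    have "w a \<in> {1..n}" "w b \<in> {1..n}" "w a \<noteq> w b"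
      using h Sym_in[OF h(1), of a] Sym_in[OF h(1), of b] by simp_all
    then show ?thesis unfolding transps_def by blast
  qed
  moreover have "w' = tp (w a) (w b) \<circ> w" using h tp_comp_Sym by metis
  moreover have "len n w < len n w'" using h len_less_comp_tp by simp
  ultimately show "bedge n w w'" using h(1) unfolding bedge_def by blast
qed

lemma bedge_comp_tp:
  assumes "w \<in> Sym n" "a \<in> {1..n}" "b \<in> {1..n}" "a < b" "w a < w b"
  shows "bedge n w (w \<circ> tp a b)"
  by (simp only: bedge_iff) (intro conjI exI[of _ a] exI[of _ b] assms refl)

lemma bedge_Sym:
  assumes "bedge n w w'"
  shows "w \<in> Sym n" "w' \<in> Sym n"
  using assms by (auto simp only: bedge_iff intro: Sym_comp_tp)

lemma rtranclp_bedge_Sym: "(bedge n)\<^sup>*\<^sup>* u v \<Longrightarrow> u \<in> Sym n \<Longrightarrow> v \<in> Sym n"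
  by (induction rule: rtranclp_induct) (auto dest: bedge_Sym)

lemma bruhat_le_Sym: "bruhat_le n u v \<Longrightarrow> u \<in> Sym n \<and> v \<in> Sym n"
  by (auto simp: bruhat_le_def rtranclp_bedge_Sym)

lemma bruhat_le_refl: "u \<in> Sym n \<Longrightarrow> bruhat_le n u u"
  by (simp add: bruhat_le_def)

lemma bruhat_le_trans: "bruhat_le n u v \<Longrightarrow> bruhat_le n v w \<Longrightarrow> bruhat_le n u w"
  by (auto simp: bruhat_le_def)

lemma bedge_imp_le: "bedge n u v \<Longrightarrow> bruhat_le n u v"
  by (auto simp: bruhat_le_def dest: bedge_Sym)

lemma bruhat_le_len: "bruhat_le n u v \<Longrightarrow> len n u \<le> len n v"
proof -
  have "(bedge n)\<^sup>*\<^sup>* u v \<Longrightarrow> len n u \<le> len n v"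
    by (induction rule: rtranclp_induct) (auto simp: bedge_def)
  then show "bruhat_le n u v \<Longrightarrow> ?thesis" by (simp add: bruhat_le_def)
qed

lemma len_comp_sref:
  assumes i: "i \<in> {1..<n}" and w: "w i < w (Suc i)"
  shows "len n (w \<circ> sref i) = Suc (len n w)"
proof -
  let ?t = "sref i"
  let ?f = "\<lambda>(k, l). (?t k, ?t l)"
  have "Inv n (w \<circ> ?t) = insert (i, Suc i) (?f ` Inv n w)"
  proof (intro equalityI subrelI)
    fix k l assume kl: "(k, l) \<in> Inv n (w \<circ> ?t)"
    show "(k, l) \<in> insert (i, Suc i) (?f ` Inv n w)"
    proof (cases "(k, l) = (i, Suc i)")
      case False
      then have "(?t k, ?t l) \<in> Inv n w"
        using kl i by (auto simp: Inv_def sref_def transpose_def split: if_splits)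
      then have "?f (?t k, ?t l) \<in> ?f ` Inv n w" by blast
      then show ?thesis by (simp add: sref_def)
    qed simp
  next
    fix k l assume "(k, l) \<in> insert (i, Suc i) (?f ` Inv n w)"
    then show "(k, l) \<in> Inv n (w \<circ> ?t)"
      using i w by (auto simp: Inv_def sref_def transpose_def split: if_splits)
  qed
  moreover have "(i, Suc i) \<notin> ?f ` Inv n w"
    by (auto simp: Inv_def sref_def transpose_def split: if_splits)
  moreover have "card (?f ` Inv n w) = card (Inv n w)"
    by (rule card_image) (auto simp: inj_on_def sref_def dest: transpose_eq_imp_eq)
  ultimately show ?thesis
    using finite_Inv by (simp add: len_eq_card_Inv)
qed

lemma Sym_comp_sref: "w \<in> Sym n \<Longrightarrow> i \<in> {1..<n} \<Longrightarrow> w \<circ> sref i \<in> Sym n"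
  unfolding sref_def by (rule Sym_comp_tp) auto

lemma comp_sref_sref [simp]: "w \<circ> sref i \<circ> sref i = w"
  by (simp add: sref_def)

lemma sref_apply [simp]: "sref i i = Suc i" "sref i (Suc i) = i"
  by (simp_all add: sref_def)

lemma sref_other: "k \<noteq> i \<Longrightarrow> k \<noteq> Suc i \<Longrightarrow> sref i k = k"
  by (simp add: sref_def)

lemma is_desc_iff:
  assumes "w \<in> Sym n"
  shows "is_desc n w i \<longleftrightarrow> i \<in> {1..<n} \<and> w (Suc i) < w i"
proof (cases "i \<in> {1..<n}")
  case True
  have "w i \<noteq> w (Suc i)" using Sym_inj[OF assms, of i "Suc i"] by simp
  then consider "w i < w (Suc i)" | "w (Suc i) < w i" by linarith
  then show ?thesis
  proof cases
    case 1
    then show ?thesis using len_comp_sref[OF True 1] by (simp add: is_desc_def)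
  next
    case 2
    then show ?thesis using len_comp_sref[OF True, of "w \<circ> sref i"] True
      by (simp add: is_desc_def)
  qed
qed (auto simp: is_desc_def)

lemma len_comp_sref_desc:
  assumes "i \<in> {1..<n}" "w (Suc i) < w i"
  shows "len n w = Suc (len n (w \<circ> sref i))"
  using len_comp_sref[OF assms(1), of "w \<circ> sref i"] assms by simp

section \<open>The rank criterion for Bruhat order\<close>

definition rk :: "perm \<Rightarrow> nat \<Rightarrow> nat \<Rightarrow> int" where
  "rk w p q = (\<Sum>i\<in>{1..p}. of_bool (q \<le> w i))"

lemma rk_0 [simp]: "rk w 0 q = 0"
  by (simp add: rk_def)

lemma rk_Suc: "rk w (Suc p) q = rk w p q + of_bool (q \<le> w (Suc p))"
  by (simp add: rk_def)

text \<open>Only prefixes containing \<open>a\<close> but not \<open>b\<close> see the exchange. If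
  \<open>w a < w b\<close>, the rank rises by one exactly on the rectangle
  \<open>a \<le> p < b\<close>, \<open>w a < q \<le> w b\<close>; later arguments compare such
  rectangles.\<close>

lemma rk_comp_tp:
  assumes "1 \<le> a" "a < b"
  shows "rk (w \<circ> tp a b) p q =
    rk w p q + of_bool (a \<le> p \<and> p < b) * (of_bool (q \<le> w b) - of_bool (q \<le> w a))"
proof (induction p)
  case 0
  then show ?case using assms by simp
next
  case (Suc p)
  consider "Suc p = a" | "Suc p = b" | "Suc p \<noteq> a" "Suc p \<noteq> b" by blast
  then show ?case
    unfolding rk_Suc Suc.IH using assms by cases auto
qed

lemma rk_full: "w \<in> Sym n \<Longrightarrow> rk w n q = (\<Sum>i\<in>{1..n}. of_bool (q \<le> i))"
  unfolding rk_def Sym_def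
  by (rule sum.reindex_bij_betw[of w "{1..n}" "{1..n}" "\<lambda>i. of_bool (q \<le> i)"])
     (simp add: permutes_imp_bij)

lemma rk_split:
  assumes "w \<in> Sym n" "p \<le> n"
  shows "rk w p q = (\<Sum>i\<in>{1..n}. of_bool (q \<le> i)) - (\<Sum>i\<in>{p<..n}. of_bool (q \<le> w i))"
proof -
  have "{1..n} = {1..p} \<union> {p<..n}" using assms by auto
  then have "rk w n q = rk w p q + (\<Sum>i\<in>{p<..n}. of_bool (q \<le> w i))"
    unfolding rk_def by (simp only:) (rule sum.union_disjoint; auto)
  then show ?thesis using rk_full[OF assms(1)] by simp
qed

lemma rk_diff:
  assumes "p \<le> p'"
  shows "rk w p' q = rk w p q + (\<Sum>i\<in>{p<..p'}. of_bool (q \<le> w i))"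
proof -
  have "{1..p'} = {1..p} \<union> {p<..p'}" using assms by auto
  then show ?thesis
    unfolding rk_def by (simp only:) (rule sum.union_disjoint; auto)
qed

lemma bedge_rk_le: "bedge n u v \<Longrightarrow> rk u p q \<le> rk v p q"
  unfolding bedge_iff by (auto simp: rk_comp_tp)

lemma bruhat_le_rk: "bruhat_le n u v \<Longrightarrow> rk u p q \<le> rk v p q"
proof -
  have "(bedge n)\<^sup>*\<^sup>* u v \<Longrightarrow> rk u p q \<le> rk v p q"
    by (induction rule: rtranclp_induct) (auto intro: order_trans bedge_rk_le)
  then show "bruhat_le n u v \<Longrightarrow> ?thesis" by (simp add: bruhat_le_def)
qed

lemma rk_interval:
  assumes "q \<le> q'"
  shows "rk w p q = rk w p q' + (\<Sum>i\<in>{1..p}. of_bool (q \<le> w i \<and> w i < q'))"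
  unfolding rk_def sum.distrib[symmetric] using assms by (intro sum.cong) auto

text \<open>At the first position \<open>a\<close> where \<open>u\<close> and \<open>v\<close> differ, \<open>u\<close> can be moved up by exchanging
  \<open>u a\<close> with the first later entry in the range \<open>(u a, v a]\<close>.\<close>

lemma rk_le_step:
  assumes u: "u \<in> Sym n" and v: "v \<in> Sym n" and "u \<noteq> v"
    and le: "\<And>p q. rk u p q \<le> rk v p q"
  shows "\<exists>u'. bedge n u u' \<and> (\<forall>p q. rk u' p q \<le> rk v p q)"
proof -
  from \<open>u \<noteq> v\<close> have "\<exists>a. u a \<noteq> v a" by auto
  define a where "a = (LEAST a. u a \<noteq> v a)"
  have a: "u a \<noteq> v a" unfolding a_def using \<open>\<exists>a. u a \<noteq> v a\<close> by (rule LeastI_ex)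
  have low: "u i = v i" if "i < a" for i
    using that not_less_Least unfolding a_def by blast
  have an: "a \<in> {1..n}" using a Sym_out u v by metis
  then obtain a' where a': "a = Suc a'" by (cases a) auto
  have "rk u a' q = rk v a' q" for q
    unfolding rk_def by (intro sum.cong) (auto simp: low a')
  then have "u a \<le> v a"
    using le[of a "u a"] by (cases "u a \<le> v a") (auto simp: a' rk_Suc)
  then have ua: "u a < v a" using a by simp
  let ?P = "\<lambda>b. a < b \<and> u a < u b \<and> u b \<le> v a"
  have "v a \<in> u ` {1..n}"
    using u Sym_in[OF v, of a] an by (simp add: Sym_def permutes_image del: One_nat_def)
  then obtain b0 where b0: "u b0 = v a" by auto
  have "a < b0"
  proof (rule ccontr)
    assume "\<not> a < b0"
    then consider "b0 = a" | "b0 < a" by linarith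
    then show False
    proof cases
      case 1 then show False using b0 a by simp
    next
      case 2 then show False using b0 low[OF 2] Sym_inj[OF v, of b0 a] by simp
    qed
  qed
  then have "?P b0" using b0 ua by simp
  define b where "b = (LEAST b. ?P b)"
  have b: "?P b" unfolding b_def using \<open>?P b0\<close> by (rule LeastI)
  have nob: "\<not> ?P i" if "i < b" for i
    using that not_less_Least unfolding b_def by blast
  have bn: "b \<in> {1..n}"
    using Sym_in[OF u, of b] Sym_in[OF v, of a] an b by auto
  \<comment> \<open>Where the exchange raises the rank, the given inequality must be strict. From
    position \<open>a\<close> up to \<open>p\<close>, \<open>u\<close> has no value in
    \<open>[q, v a]\<close> by minimality of \<open>b\<close>, while \<open>v\<close> has
    \<open>v a\<close>; the rank inequality at \<open>Suc (v a)\<close> then leaves one unit of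
    slack.\<close>
  have "rk (u \<circ> tp a b) p q \<le> rk v p q" for p q
  proof (cases "a \<le> p \<and> p < b \<and> u a < q \<and> q \<le> u b")
    case True
    then have qv: "q \<le> Suc (v a)" using b by simp
    have "(\<Sum>i\<in>{1..p}. of_bool (q \<le> u i \<and> u i < Suc (v a)))
        = (\<Sum>i\<in>{1..<a}. of_bool (q \<le> u i \<and> u i < Suc (v a)) :: int)"
    proof (rule sum.mono_neutral_right)
      show "\<forall>i\<in>{1..p} - {1..<a}. of_bool (q \<le> u i \<and> u i < Suc (v a)) = (0::int)"
      proof
        fix i assume i: "i \<in> {1..p} - {1..<a}"
        then have "i = a \<or> a < i" "i < b" using True by auto
        then show "of_bool (q \<le> u i \<and> u i < Suc (v a)) = (0::int)"
          using nob[of i] True by auto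
      qed
    qed (use True in auto)
    also have "\<dots> = (\<Sum>i\<in>{1..<a}. of_bool (q \<le> v i \<and> v i < Suc (v a)))"
      by (intro sum.cong) (auto simp: low)
    finally have eu: "(\<Sum>i\<in>{1..p}. of_bool (q \<le> u i \<and> u i < Suc (v a)))
        = (\<Sum>i\<in>{1..<a}. of_bool (q \<le> v i \<and> v i < Suc (v a)) :: int)" .
    have "(\<Sum>i\<in>insert a {1..<a}. of_bool (q \<le> v i \<and> v i < Suc (v a)) :: int)
        \<le> (\<Sum>i\<in>{1..p}. of_bool (q \<le> v i \<and> v i < Suc (v a)))"
      using True an by (intro sum_mono2) auto
    then have ev: "1 + (\<Sum>i\<in>{1..<a}. of_bool (q \<le> v i \<and> v i < Suc (v a)) :: int)
        \<le> (\<Sum>i\<in>{1..p}. of_bool (q \<le> v i \<and> v i < Suc (v a)))"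
      using True b by simp
    have "rk u p q + 1 \<le> rk v p q"
      using eu ev le[of p "Suc (v a)"] rk_interval[OF qv, of u p] rk_interval[OF qv, of v p]
      by linarith
    then show ?thesis using an b by (simp add: rk_comp_tp)
  next
    case False
    then have "rk (u \<circ> tp a b) p q = rk u p q"
      using an b by (auto simp: rk_comp_tp)
    then show ?thesis using le by simp
  qed
  moreover have "bedge n u (u \<circ> tp a b)"
    using u an bn b by (intro bedge_comp_tp) auto
  ultimately show ?thesis by blast
qed

lemma len_le: "len n w \<le> n * n"
proof -
  have "card (Inv n w) \<le> card ({1..n} \<times> {1..n})"
    by (rule card_mono) (auto simp: Inv_def)
  then show ?thesis by (simp add: len_eq_card_Inv)
qed

text \<open>The converse iterates \<open>rk_le_step\<close>, which raises the length; the bound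
  \<open>n * n\<close> makes this stop.\<close>

lemma bruhat_le_iff_rk:
  "bruhat_le n u v \<longleftrightarrow> u \<in> Sym n \<and> v \<in> Sym n \<and> (\<forall>p q. rk u p q \<le> rk v p q)"
proof
  assume "bruhat_le n u v"
  then show "u \<in> Sym n \<and> v \<in> Sym n \<and> (\<forall>p q. rk u p q \<le> rk v p q)"
    by (simp add: bruhat_le_Sym bruhat_le_rk)
next
  assume "u \<in> Sym n \<and> v \<in> Sym n \<and> (\<forall>p q. rk u p q \<le> rk v p q)"
  then show "bruhat_le n u v"
  proof (induction "n * n - len n u" arbitrary: u rule: less_induct)
    case less
    show ?case
    proof (cases "u = v")
      case True
      then show ?thesis using less by (simp add: bruhat_le_refl)
    next
      case False
      then obtain u' where u': "bedge n u u'" "\<forall>p q. rk u' p q \<le> rk v p q"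
        using rk_le_step less by blast
      have "n * n - len n u' < n * n - len n u"
        using u' len_le[of n u'] by (auto simp: bedge_def)
      then have "bruhat_le n u' v" using less u' bedge_Sym by blast
      then show ?thesis using u' bedge_imp_le bruhat_le_trans by blast
    qed
  qed
qed

text \<open>Complementing the rank at \<open>m - 1\<close> counts large entries from position
  \<open>m\<close> on, with the inequality reversed. At the threshold \<open>w m\<close>, agreement
  beyond \<open>m\<close> leaves only \<open>u m\<close> and \<open>w m\<close> to compare.\<close>

lemma bruhat_le_at_last:
  assumes le: "bruhat_le n u w" and agree: "\<And>k. k > m \<Longrightarrow> u k = w k"
  shows "w m \<le> u m"
proof (cases "m \<in> {1..n}")
  case False
  then show ?thesis using bruhat_le_Sym[OF le] Sym_out[of u n m] Sym_out[of w n m] by simp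
next
  case True
  show ?thesis
  proof (rule ccontr)
    assume less: "\<not> w m \<le> u m"
    have set: "{m - 1<..n} = insert m {m<..n}" using True by auto
    have "rk x (m - 1) q = (\<Sum>i\<in>{1..n}. of_bool (q \<le> i))
        - (of_bool (q \<le> x m) + (\<Sum>i\<in>{m<..n}. of_bool (q \<le> x i)))" if "x \<in> Sym n" for x q
    proof -
      have "m - 1 \<le> n" using True by auto
      then show ?thesis unfolding rk_split[OF that \<open>m - 1 \<le> n\<close>] set by (simp del: sum_of_bool_eq)
    qed
    moreover have "(\<Sum>i\<in>{m<..n}. of_bool (w m \<le> u i)) = (\<Sum>i\<in>{m<..n}. of_bool (w m \<le> w i) :: int)"
      by (intro sum.cong) (auto simp: agree)
    ultimately show False
      using less bruhat_le_rk[OF le, of "m - 1" "w m"] bruhat_le_Sym[OF le]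
      by (simp del: sum_of_bool_eq One_nat_def)
  qed
qed

text \<open>At the last position beyond \<open>m\<close> where \<open>x\<close> and \<open>u\<close>
  differ, \<open>bruhat_le_at_last\<close> for \<open>u \<le> x\<close> and for
  \<open>x \<le> v\<close> squeezes the entry of \<open>x\<close> between two equal ones.\<close>

lemma bruhat_le_agree_between:
  assumes "bruhat_le n u x" "bruhat_le n x v" and agree: "\<And>k. k > m \<Longrightarrow> u k = v k"
    and "k > m"
  shows "x k = u k"
proof (rule ccontr)
  assume neq: "x k \<noteq> u k"
  let ?K = "{k. k > m \<and> x k \<noteq> u k}"
  have S: "u \<in> Sym n" "x \<in> Sym n" using assms bruhat_le_Sym by blast+
  have "?K \<subseteq> {1..n}"
  proof
    fix k assume "k \<in> ?K"
    then show "k \<in> {1..n}" using S Sym_out by (metis (mono_tags, lifting) mem_Collect_eq)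
  qed
  then have fin: "finite ?K" by (rule finite_subset) simp
  define l where "l = Max ?K"
  have l: "l \<in> ?K" unfolding l_def using fin neq \<open>k > m\<close> by (intro Max_in) auto
  have beyond: "x k = u k" if "k > l" for k
    using Max_ge[OF fin, of k] that l by (fastforce simp: l_def)
  have "x l \<le> u l"
    by (rule bruhat_le_at_last[OF assms(1)]) (simp add: beyond)
  moreover have "v l \<le> x l"
    by (rule bruhat_le_at_last[OF assms(2)]) (use l beyond agree in auto)
  ultimately show False using l agree by auto
qed

text \<open>If \<open>x i < x (i + 1)\<close>, then \<open>rk (x \<circ> sref i) i q\<close> is the minimum of \<open>rk x (i - 1) q + 1\<close> and
  \<open>rk x (i + 1) q\<close>, hence monotone in \<open>rk x\<close>.\<close>

lemma bruhat_le_lift: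
  assumes le: "bruhat_le n x y" and i: "i \<in> {1..<n}"
    and x: "x i < x (Suc i)" and y: "y i < y (Suc i)"
  shows "bruhat_le n (x \<circ> sref i) (y \<circ> sref i)"
proof -
  obtain j where j: "i = Suc j" using i by (cases i) auto
  have "rk (x \<circ> sref i) p q \<le> rk (y \<circ> sref i) p q" for p q
  proof (cases "p = i")
    case True
    note l = bruhat_le_rk[OF le, of j q] bruhat_le_rk[OF le, of "Suc j" q]
      bruhat_le_rk[OF le, of "Suc (Suc j)" q]
    show ?thesis
      using x y l unfolding True sref_def
      by (cases "q \<le> x (Suc j)"; cases "q \<le> x (Suc (Suc j))";
          cases "q \<le> y (Suc j)"; cases "q \<le> y (Suc (Suc j))")
         (simp_all add: rk_comp_tp rk_Suc j)
  next
    case False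
    then have "\<not> (i \<le> p \<and> p < Suc i)" by simp
    then show ?thesis
      using i bruhat_le_rk[OF le] unfolding sref_def by (subst (1 2) rk_comp_tp) auto
  qed
  then show ?thesis
    using bruhat_le_Sym[OF le] i by (simp add: bruhat_le_iff_rk Sym_comp_sref)
qed

lemma bruhat_le_up_sref:
  assumes "w \<in> Sym n" "i \<in> {1..<n}" "w i < w (Suc i)"
  shows "bruhat_le n w (w \<circ> sref i)"
  unfolding sref_def using assms by (intro bedge_imp_le bedge_comp_tp) auto

lemma bruhat_le_down_sref:
  assumes "w \<in> Sym n" "i \<in> {1..<n}" "w (Suc i) < w i"
  shows "bruhat_le n (w \<circ> sref i) w"
  using bruhat_le_up_sref[OF Sym_comp_sref[OF assms(1,2)] assms(2)] assms by simp

section \<open>The recursion for \<open>Rtilde\<close>\<close>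

abbreviation ev :: "int poly \<Rightarrow> real \<Rightarrow> real" where
  "ev p x \<equiv> poly (map_poly real_of_int p) x"

lemma ev_add: "ev (p + q) x = ev p x + ev q x"
proof -
  have "map_poly real_of_int (p + q) = map_poly real_of_int p + map_poly real_of_int q"
    by (rule poly_eqI) (simp add: coeff_map_poly)
  then show ?thesis by simp
qed

lemma ev_pCons: "ev (pCons a p) x = real_of_int a + x * ev p x"
  by (simp add: map_poly_pCons)

lemma ev_linear_mult: "ev ([:a, 1:] * p) x = (real_of_int a + x) * ev p x"
proof -
  have smult: "ev (smult a p) x = real_of_int a * ev p x"
  proof -
    have "map_poly real_of_int (smult a p) = smult (real_of_int a) (map_poly real_of_int p)"
      by (rule poly_eqI) (simp add: coeff_map_poly)
    then show ?thesis by simp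
  qed
  have "[:a, 1:] * p = smult a p + pCons 0 p" by simp
  then show ?thesis by (simp only: ev_add ev_pCons smult) (simp add: algebra_simps)
qed

definition is_Rtilde :: "nat \<Rightarrow> perm \<Rightarrow> perm \<Rightarrow> int poly \<Rightarrow> bool" where
  "is_Rtilde n u v p \<longleftrightarrow> (\<forall>q :: real. q > 0 \<longrightarrow>
     ev (Rpoly n u v) q = q powr (real (len n v - len n u) / 2) * ev p (sqrt q - 1 / sqrt q))"

lemma is_Rtilde_unique:
  assumes "is_Rtilde n u v p" "is_Rtilde n u v p'"
  shows "p = p'"
proof -
  have "ev p t = ev p' t" for t :: real
  proof -
    \<comment> \<open>The positive root of \<open>s^2 - t * s - 1 = 0\<close>: every real
      \<open>t\<close> is \<open>s - 1 / s\<close>, so evaluating at \<open>q = s^2\<close> makes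
      the two polynomials agree at every \<open>t\<close>.\<close>
    define s where "s = (t + sqrt (t\<^sup>2 + 4)) / 2"
    have "\<bar>t\<bar> < sqrt (t\<^sup>2 + 4)" by (rule real_less_rsqrt) simp
    then have s: "s > 0" unfolding s_def by (auto simp: abs_less_iff)
    have "s\<^sup>2 - 1 = t * s"
      unfolding s_def by (simp add: field_simps power2_eq_square)
    then have "s - 1 / s = t" using s by (simp add: field_simps power2_eq_square)
    moreover have "sqrt (s\<^sup>2) = s" "s\<^sup>2 > 0" using s by auto
    ultimately show ?thesis
      using assms unfolding is_Rtilde_def by (metis mult_left_cancel powr_eq_0_iff less_irrefl)
  qed
  then have "poly (map_poly real_of_int p) = poly (map_poly real_of_int p')" by auto
  then have "map_poly real_of_int p = map_poly real_of_int p'"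
    by (simp add: poly_eq_poly_eq_iff)
  then have "coeff (map_poly real_of_int p) k = coeff (map_poly real_of_int p') k" for k by simp
  then show ?thesis by (intro poly_eqI) (simp add: coeff_map_poly)
qed

lemma Rtilde_eqI: "is_Rtilde n u v p \<Longrightarrow> Rtilde n u v = p"
  unfolding Rtilde_def using is_Rtilde_unique
  by (intro the_equality) (auto simp: is_Rtilde_def)

lemma is_Rtilde_0: "Rpoly n u v = 0 \<Longrightarrow> is_Rtilde n u v 0"
  by (simp add: is_Rtilde_def)

declare Rpoly.simps [simp del]

lemma Rpoly_not_le: "\<not> bruhat_le n u v \<Longrightarrow> Rpoly n u v = 0"
  by (subst Rpoly.simps) simp

lemma Rtilde_not_le: "\<not> bruhat_le n u v \<Longrightarrow> Rtilde n u v = 0"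
  by (intro Rtilde_eqI is_Rtilde_0 Rpoly_not_le)

lemma is_Rtilde_refl: "v \<in> Sym n \<Longrightarrow> is_Rtilde n v v 1"
  unfolding is_Rtilde_def by (subst Rpoly.simps) (simp add: bruhat_le_refl)

lemma Rtilde_refl: "v \<in> Sym n \<Longrightarrow> Rtilde n v v = 1"
  by (rule Rtilde_eqI[OF is_Rtilde_refl])

lemma is_Rtilde_step_desc:
  assumes i: "i \<in> {1..<n}"
    and ui: "u (Suc i) < u i" and vi: "v (Suc i) < v i"
    and R: "Rpoly n u v = Rpoly n (u \<circ> sref i) (v \<circ> sref i)"
    and p: "is_Rtilde n (u \<circ> sref i) (v \<circ> sref i) p"
  shows "is_Rtilde n u v p"
  using p len_comp_sref_desc[OF i ui] len_comp_sref_desc[OF i vi]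
  unfolding is_Rtilde_def R by simp

text \<open>The factor \<open>q\<close> compensates a drop of the length difference by two. A drop
  by one costs \<open>sqrt q\<close>, and \<open>q - 1 = sqrt q * (sqrt q - 1 / sqrt q)\<close>
  supplies it together with the factor \<open>X\<close>.\<close>

lemma is_Rtilde_step_asc:
  assumes i: "i \<in> {1..<n}"
    and ui: "u i < u (Suc i)" and vi: "v (Suc i) < v i"
    and R: "Rpoly n u v = [:0, 1:] * Rpoly n (u \<circ> sref i) (v \<circ> sref i)
             + [:-1, 1:] * Rpoly n u (v \<circ> sref i)"
    and p: "is_Rtilde n (u \<circ> sref i) (v \<circ> sref i) p"
    and p': "is_Rtilde n u (v \<circ> sref i) p'"
  shows "is_Rtilde n u v (p + X * p')"
  unfolding is_Rtilde_def
proof (intro allI impI)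
  fix q :: real assume q: "q > 0"
  define t where "t = sqrt q - 1 / sqrt q"
  define L where "L = real (len n v - len n u)"
  note lu = len_comp_sref[OF i ui] and lv = len_comp_sref_desc[OF i vi]
  have qt: "q - 1 = q powr (1/2) * t"
    using q by (simp add: t_def powr_half_sqrt field_simps)
  \<comment> \<open>The exponent contains a truncated subtraction of lengths, which is computed
    under comparability in Bruhat order; without comparability both sides are zero.\<close>
  have 1: "q * ev (Rpoly n (u \<circ> sref i) (v \<circ> sref i)) q = q powr (L / 2) * ev p t"
  proof (cases "bruhat_le n (u \<circ> sref i) (v \<circ> sref i)")
    case True
    have e: "ev (Rpoly n (u \<circ> sref i) (v \<circ> sref i)) q
        = q powr (real (len n (v \<circ> sref i) - len n (u \<circ> sref i)) / 2) * ev p t"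
      using p q unfolding is_Rtilde_def t_def by blast
    have "real (len n (v \<circ> sref i) - len n (u \<circ> sref i)) / 2 = L / 2 - 1"
      using bruhat_le_len[OF True] lu lv by (simp add: L_def field_simps)
    moreover have "q powr (L / 2) = q * q powr (L / 2 - 1)" using q by (simp add: powr_diff)
    ultimately show ?thesis unfolding e by (simp only: mult.assoc)
  next
    case False
    then have "Rpoly n (u \<circ> sref i) (v \<circ> sref i) = 0" by (rule Rpoly_not_le)
    moreover from this have "p = 0"
      using is_Rtilde_unique[OF p] is_Rtilde_0 by blast
    ultimately show ?thesis by simp
  qed
  have 2: "(q - 1) * ev (Rpoly n u (v \<circ> sref i)) q = q powr (L / 2) * (t * ev p' t)"
  proof (cases "bruhat_le n u (v \<circ> sref i)")
    case True
    have e: "ev (Rpoly n u (v \<circ> sref i)) q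
        = q powr (real (len n (v \<circ> sref i) - len n u) / 2) * ev p' t"
      using p' q unfolding is_Rtilde_def t_def by blast
    have "L / 2 = 1 / 2 + real (len n (v \<circ> sref i) - len n u) / 2"
      using bruhat_le_len[OF True] lv by (simp add: L_def field_simps)
    then have "q powr (L / 2) = q powr (1 / 2) * q powr (real (len n (v \<circ> sref i) - len n u) / 2)"
      by (simp only: powr_add)
    then show ?thesis unfolding e qt by (simp only: mult.assoc mult.left_commute)
  next
    case False
    then have "Rpoly n u (v \<circ> sref i) = 0" by (rule Rpoly_not_le)
    moreover from this have "p' = 0"
      using is_Rtilde_unique[OF p'] is_Rtilde_0 by blast
    ultimately show ?thesis by simp
  qed
  have 3: "ev (X * p') t = t * ev p' t"
    unfolding X_def by (simp only: ev_linear_mult) simp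
  have "ev (Rpoly n u v) q = q powr (L / 2) * ev (p + X * p') t"
    unfolding R ev_add 3 using 1 2 by (simp only: ev_linear_mult) (simp add: algebra_simps)
  then show "ev (Rpoly n u v) q = q powr (real (len n v - len n u) / 2)
       * ev (p + X * p') (sqrt q - 1 / sqrt q)"
    unfolding L_def t_def .
qed

lemma Rpoly_step:
  assumes "bruhat_le n u v" "u \<noteq> v" "\<exists>i. is_desc n v i"
  shows "Rpoly n u v = (let i = (LEAST i. is_desc n v i) in
           if is_desc n u i then Rpoly n (u \<circ> sref i) (v \<circ> sref i)
           else [:0, 1:] * Rpoly n (u \<circ> sref i) (v \<circ> sref i)
                + [:-1, 1:] * Rpoly n u (v \<circ> sref i))"
  by (subst Rpoly.simps) (use assms in auto)

lemma not_desc_asc: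
  "w \<in> Sym n \<Longrightarrow> \<not> w (Suc i) < w i \<longleftrightarrow> w i < w (Suc i)"
  using Sym_inj[of w n i "Suc i"] by auto

lemma is_Rtilde_Rtilde:
  assumes "u \<in> Sym n" "v \<in> Sym n"
  shows "is_Rtilde n u v (Rtilde n u v)"
  using assms
proof (induction "len n v" arbitrary: u v rule: less_induct)
  case less
  have "\<exists>p. is_Rtilde n u v p"
  proof (cases "bruhat_le n u v \<and> u \<noteq> v \<and> (\<exists>i. is_desc n v i)")
    case False
    then consider "\<not> bruhat_le n u v" | "u = v" | "bruhat_le n u v" "u \<noteq> v" "\<not> (\<exists>i. is_desc n v i)"
      by blast
    then show ?thesis
    proof cases
      case 1
      then show ?thesis using is_Rtilde_0 Rpoly_not_le by blast
    next
      case 2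
      then show ?thesis using is_Rtilde_refl less by blast
    next
      case 3
      then have "Rpoly n u v = 0" by (subst Rpoly.simps) simp
      then show ?thesis using is_Rtilde_0 by blast
    qed
  next
    case True
    define i where "i = (LEAST i. is_desc n v i)"
    have iv: "is_desc n v i" unfolding i_def using True by (blast intro: LeastI)
    then have i: "i \<in> {1..<n}" "v (Suc i) < v i" using is_desc_iff less by blast+
    have lv: "len n (v \<circ> sref i) < len n v" using iv by (simp add: is_desc_def)
    have us: "u \<circ> sref i \<in> Sym n" "v \<circ> sref i \<in> Sym n"
      using less i by (auto intro: Sym_comp_sref)
    note IH = less(1)[OF lv us] less(1)[OF lv less(2) us(2)]
    note R = Rpoly_step[of n u v, folded i_def, unfolded Let_def]
    show ?thesis
    proof (cases "u (Suc i) < u i")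
      case True': True
      then have "is_desc n u i" using is_desc_iff i less by blast
      then have "Rpoly n u v = Rpoly n (u \<circ> sref i) (v \<circ> sref i)"
        using R True by simp
      from is_Rtilde_step_desc[OF i(1) True' i(2) this IH(1)]
      show ?thesis by blast
    next
      case False
      then have ui: "u i < u (Suc i)" using not_desc_asc less by blast
      have "\<not> is_desc n u i" using is_desc_iff False less by blast
      then have "Rpoly n u v = [:0, 1:] * Rpoly n (u \<circ> sref i) (v \<circ> sref i)
             + [:-1, 1:] * Rpoly n u (v \<circ> sref i)"
        using R True by simp
      from is_Rtilde_step_asc[OF i(1) ui i(2) this IH]
      show ?thesis by blast
    qed
  qed
  then show ?case using Rtilde_eqI by blast
qed

text \<open>A normalised Hecke algebra generator acting on functions of a permutation: the relations
  below are the commutation, braid and quadratic relations, the last reading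
  \<open>T^2 = 1 + X * T\<close>.\<close>

definition Dop :: "nat \<Rightarrow> (perm \<Rightarrow> int poly) \<Rightarrow> perm \<Rightarrow> int poly" where
  "Dop i f u = f (u \<circ> sref i) + (if u i < u (Suc i) then X * f u else 0)"

text \<open>One formula for every \<open>u\<close>, so that operators can act on
  \<open>\<lambda>w. Rtilde n w v\<close> as a whole. If \<open>u\<close> is not below
  \<open>v\<close>, lifting and transitivity show that both terms on the right vanish.\<close>

lemma Rtilde_least_desc:
  assumes u: "u \<in> Sym n" and v: "v \<in> Sym n" and ex: "\<exists>i. is_desc n v i"
    and i_def: "i = (LEAST i. is_desc n v i)"
  shows "Rtilde n u v = Dop i (\<lambda>w. Rtilde n w (v \<circ> sref i)) u"
proof -
  have iv: "is_desc n v i" unfolding i_def using ex by (blast intro: LeastI)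
  then have i: "i \<in> {1..<n}" "v (Suc i) < v i" using is_desc_iff v by blast+
  have us: "u \<circ> sref i \<in> Sym n" "v \<circ> sref i \<in> Sym n"
    using u v i by (auto intro: Sym_comp_sref)
  have vv: "bruhat_le n (v \<circ> sref i) v" using bruhat_le_down_sref v i by blast
  note IH = is_Rtilde_Rtilde[OF us] is_Rtilde_Rtilde[OF u us(2)]
  consider "\<not> bruhat_le n u v" | "u = v" | "bruhat_le n u v" "u \<noteq> v" by blast
  then show ?thesis
  proof cases
    case 1
    have n1: "\<not> bruhat_le n u (v \<circ> sref i)" using 1 vv bruhat_le_trans by blast
    have n2: "\<not> bruhat_le n (u \<circ> sref i) (v \<circ> sref i)"
    proof
      assume le: "bruhat_le n (u \<circ> sref i) (v \<circ> sref i)"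
      have "bruhat_le n u v"
      proof (cases "u i < u (Suc i)")
        case True
        then show ?thesis using le bruhat_le_up_sref[OF u i(1)] vv bruhat_le_trans by blast
      next
        case False
        then have "u (Suc i) < u i" using not_desc_asc[OF u] by blast
        then show ?thesis using bruhat_le_lift[OF le i(1)] i by simp
      qed
      then show False using 1 by simp
    qed
    show ?thesis using 1 n1 n2 by (simp add: Dop_def Rtilde_not_le)
  next
    case 2
    then show ?thesis using i us v by (simp add: Dop_def Rtilde_refl)
  next
    case 3
    note R = Rpoly_step[OF 3 ex, folded i_def, unfolded Let_def]
    show ?thesis
    proof (cases "u (Suc i) < u i")
      case True
      then have "is_desc n u i" using is_desc_iff i u by blast
      then have "Rpoly n u v = Rpoly n (u \<circ> sref i) (v \<circ> sref i)"
        using R by simp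
      from is_Rtilde_step_desc[OF i(1) True i(2) this IH(1)] True
      show ?thesis by (simp add: Rtilde_eqI Dop_def)
    next
      case False
      then have ui: "u i < u (Suc i)" using not_desc_asc u by blast
      have "\<not> is_desc n u i" using is_desc_iff False u by blast
      then have "Rpoly n u v = [:0, 1:] * Rpoly n (u \<circ> sref i) (v \<circ> sref i)
             + [:-1, 1:] * Rpoly n u (v \<circ> sref i)"
        using R by simp
      from is_Rtilde_step_asc[OF i(1) ui i(2) this IH]
      have "Rtilde n u v = Rtilde n (u \<circ> sref i) (v \<circ> sref i) + X * Rtilde n u (v \<circ> sref i)"
        by (rule Rtilde_eqI)
      then show ?thesis using ui by (simp add: Dop_def)
    qed
  qed
qed

section \<open>Hecke relations and independence of the chosen descent\<close>

lemma Dop_comm: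
  assumes "Suc i < j"
  shows "Dop i (Dop j f) u = Dop j (Dop i f) u"
proof -
  have c: "u \<circ> sref j \<circ> sref i = u \<circ> sref i \<circ> sref j"
    by (rule ext) (use assms in \<open>auto simp: sref_def transpose_def\<close>)
  show ?thesis
    unfolding Dop_def c using assms by (auto simp: sref_other algebra_simps)
qed

text \<open>Only the relative order of the entries at \<open>i\<close>, \<open>i + 1\<close>,
  \<open>i + 2\<close> matters; injectivity leaves six orders, in each of which the expansions
  coincide.\<close>

lemma Dop_braid:
  assumes "inj u"
  shows "Dop i (Dop (Suc i) (Dop i f)) u = Dop (Suc i) (Dop i (Dop (Suc i) f)) u"
proof -
  have c: "u \<circ> sref (Suc i) \<circ> sref i \<circ> sref (Suc i) = u \<circ> sref i \<circ> sref (Suc i) \<circ> sref i"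
    by (rule ext) (auto simp: sref_def transpose_def)
  have "u i \<noteq> u (Suc i)" "u i \<noteq> u (Suc (Suc i))" "u (Suc i) \<noteq> u (Suc (Suc i))"
    by (simp_all add: inj_eq[OF assms])
  then show ?thesis
    unfolding Dop_def
    by (cases "u i < u (Suc i)"; cases "u i < u (Suc (Suc i))"; cases "u (Suc i) < u (Suc (Suc i))")
       (simp_all add: sref_other c algebra_simps)
qed

lemma Dop_square:
  assumes "inj u"
  shows "Dop i (Dop i f) u = f u + X * Dop i f u"
proof -
  have "u i \<noteq> u (Suc i)" using assms by (auto dest: injD)
  then show ?thesis
    unfolding Dop_def by (cases "u i < u (Suc i)") (simp_all add: algebra_simps)
qed

lemma Dop_cong:
  assumes "u \<in> Sym n" "i \<in> {1..<n}" "\<And>w. w \<in> Sym n \<Longrightarrow> f w = g w"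
  shows "Dop i f u = Dop i g u"
  using assms by (simp add: Dop_def Sym_comp_sref)

lemma Sym_imp_inj: "u \<in> Sym n \<Longrightarrow> inj u"
  by (simp add: Sym_def permutes_inj)

text \<open>If \<open>v\<close> descends at \<open>i\<close> and at the least descent
  \<open>j\<close>, the longest element of the group generated by the two reflections splits off
  \<open>v\<close>. The induction hypothesis unfolds it along either of its two reduced words, and
  the resulting operators agree by \<open>Dop_comm\<close> or \<open>Dop_braid\<close>.\<close>

lemma Rtilde_desc:
  assumes "u \<in> Sym n" "v \<in> Sym n" "i \<in> {1..<n}" "v (Suc i) < v i"
  shows "Rtilde n u v = Dop i (\<lambda>w. Rtilde n w (v \<circ> sref i)) u"
  using assms
proof (induction "len n v" arbitrary: u v i rule: less_induct)
  case less
  define j where "j = (LEAST j. is_desc n v j)"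
  have "is_desc n v i" using less is_desc_iff by blast
  then have ex: "\<exists>j. is_desc n v j" by blast
  then have "is_desc n v j" unfolding j_def by (blast intro: LeastI)
  then have j: "j \<in> {1..<n}" "v (Suc j) < v j" using is_desc_iff less by blast+
  note i = less(4,5)
  have least: "Rtilde n u v = Dop j (\<lambda>w. Rtilde n w (v \<circ> sref j)) u"
    by (rule Rtilde_least_desc[OF less(2,3) ex j_def])
  have IH: "Rtilde n w v' = Dop k (\<lambda>w. Rtilde n w (v' \<circ> sref k)) w"
    if "len n v' < len n v" "w \<in> Sym n" "v' \<in> Sym n" "k \<in> {1..<n}" "v' (Suc k) < v' k" for w v' k
    using less(1)[OF that] .
  note S = Sym_comp_sref[of _ n]
  have far: "Dop a (\<lambda>w. Rtilde n w (v \<circ> sref a)) u = Dop b (\<lambda>w. Rtilde n w (v \<circ> sref b)) u"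
    if ab: "Suc a < b" and a: "a \<in> {1..<n}" "v (Suc a) < v a" and b: "b \<in> {1..<n}" "v (Suc b) < v b"
    for a b
  proof -
    have c: "v \<circ> sref b \<circ> sref a = v \<circ> sref a \<circ> sref b"
      by (rule ext) (use ab in \<open>auto simp: sref_def transpose_def\<close>)
    have l: "len n (v \<circ> sref a) < len n v" "len n (v \<circ> sref b) < len n v"
      using len_comp_sref_desc[OF a] len_comp_sref_desc[OF b] by simp_all
    have A: "Rtilde n w (v \<circ> sref a) = Dop b (\<lambda>w. Rtilde n w (v \<circ> sref a \<circ> sref b)) w"
      if "w \<in> Sym n" for w
      using that a b ab less(3) by (intro IH l S) (auto simp: sref_other)
    have B: "Rtilde n w (v \<circ> sref b) = Dop a (\<lambda>w. Rtilde n w (v \<circ> sref a \<circ> sref b)) w"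
      if "w \<in> Sym n" for w
      unfolding c[symmetric]
      using that a b ab less(3) by (intro IH l S) (auto simp: sref_other)
    have "Dop a (\<lambda>w. Rtilde n w (v \<circ> sref a)) u
        = Dop a (Dop b (\<lambda>w. Rtilde n w (v \<circ> sref a \<circ> sref b))) u"
      by (rule Dop_cong[OF less(2) a(1) A])
    also have "\<dots> = Dop b (Dop a (\<lambda>w. Rtilde n w (v \<circ> sref a \<circ> sref b))) u"
      by (rule Dop_comm[OF ab])
    also have "\<dots> = Dop b (\<lambda>w. Rtilde n w (v \<circ> sref b)) u"
      by (rule Dop_cong[OF less(2) b(1) B[symmetric]])
    finally show ?thesis .
  qed
  have near: "Dop a (\<lambda>w. Rtilde n w (v \<circ> sref a)) u = Dop b (\<lambda>w. Rtilde n w (v \<circ> sref b)) u"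
    if ab: "b = Suc a" and a: "a \<in> {1..<n}" "v (Suc a) < v a" and b: "b \<in> {1..<n}" "v (Suc b) < v b"
    for a b
  proof -
    let ?v = "v \<circ> sref a \<circ> sref b \<circ> sref a"
    have c: "?v = v \<circ> sref b \<circ> sref a \<circ> sref b"
      by (rule ext) (use ab in \<open>auto simp: sref_def transpose_def\<close>)
    have l: "len n (v \<circ> sref a) < len n v" "len n (v \<circ> sref b) < len n v"
      using len_comp_sref_desc[OF a] len_comp_sref_desc[OF b] by simp_all
    have l': "len n (v \<circ> sref a \<circ> sref b) < len n v" "len n (v \<circ> sref b \<circ> sref a) < len n v"
      using len_comp_sref_desc[OF b(1), of "v \<circ> sref a"] l
        len_comp_sref_desc[OF a(1), of "v \<circ> sref b"] a b ab by (auto simp: sref_other)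
    have A: "Rtilde n w (v \<circ> sref a \<circ> sref b) = Dop a (\<lambda>w. Rtilde n w ?v) w"
      if "w \<in> Sym n" for w
      using that a b ab less(3) by (intro IH l' S) (auto simp: sref_other)
    have A': "Rtilde n w (v \<circ> sref a) = Dop b (Dop a (\<lambda>w. Rtilde n w ?v)) w" if "w \<in> Sym n" for w
    proof -
      have "Rtilde n w (v \<circ> sref a) = Dop b (\<lambda>w. Rtilde n w (v \<circ> sref a \<circ> sref b)) w"
        using that a b ab less(3) by (intro IH l S) (auto simp: sref_other)
      also have "\<dots> = Dop b (Dop a (\<lambda>w. Rtilde n w ?v)) w"
        by (rule Dop_cong[OF that b(1) A])
      finally show ?thesis .
    qed
    have B: "Rtilde n w (v \<circ> sref b \<circ> sref a) = Dop b (\<lambda>w. Rtilde n w ?v) w"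
      if "w \<in> Sym n" for w
      unfolding c using that a b ab less(3) by (intro IH l' S) (auto simp: sref_other)
    have B': "Rtilde n w (v \<circ> sref b) = Dop a (Dop b (\<lambda>w. Rtilde n w ?v)) w" if "w \<in> Sym n" for w
    proof -
      have "Rtilde n w (v \<circ> sref b) = Dop a (\<lambda>w. Rtilde n w (v \<circ> sref b \<circ> sref a)) w"
        using that a b ab less(3) by (intro IH l S) (auto simp: sref_other)
      also have "\<dots> = Dop a (Dop b (\<lambda>w. Rtilde n w ?v)) w"
        by (rule Dop_cong[OF that a(1) B])
      finally show ?thesis .
    qed
    have "Dop a (\<lambda>w. Rtilde n w (v \<circ> sref a)) u = Dop a (Dop b (Dop a (\<lambda>w. Rtilde n w ?v))) u"
      by (rule Dop_cong[OF less(2) a(1) A'])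
    also have "\<dots> = Dop b (Dop a (Dop b (\<lambda>w. Rtilde n w ?v))) u"
      unfolding ab by (rule Dop_braid[OF Sym_imp_inj[OF less(2)]])
    also have "\<dots> = Dop b (\<lambda>w. Rtilde n w (v \<circ> sref b)) u"
      by (rule Dop_cong[OF less(2) b(1) B'[symmetric]])
    finally show ?thesis .
  qed
  consider "i = j" | "Suc i < j" | "Suc j < i" | "j = Suc i" | "i = Suc j" by linarith
  then show ?case
  proof cases
    case 1 then show ?thesis using least by simp
  next
    case 2 then show ?thesis using least far[OF 2 i j] by simp
  next
    case 3 then show ?thesis using least far[OF 3 j i] by simp
  next
    case 4 then show ?thesis using least near[OF 4 i j] by simp
  next
    case 5 then show ?thesis using least near[OF 5 j i] by simp
  qed
qed

text \<open>The operator on the first argument becomes one on the second: by the quadratic relation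
  if \<open>x\<close> descends at \<open>i\<close>, and otherwise by the recursion for
  \<open>x \<circ> sref i\<close>.\<close>

lemma Dop_Rtilde:
  assumes "u \<in> Sym n" "x \<in> Sym n" "i \<in> {1..<n}"
  shows "Dop i (\<lambda>w. Rtilde n w x) u =
    Rtilde n u (x \<circ> sref i) + (if x (Suc i) < x i then X * Rtilde n u x else 0)"
proof (cases "x (Suc i) < x i")
  case True
  have eq: "Rtilde n w x = Dop i (\<lambda>w. Rtilde n w (x \<circ> sref i)) w" if "w \<in> Sym n" for w
    using Rtilde_desc[OF that assms(2,3) True] .
  have "Dop i (\<lambda>w. Rtilde n w x) u = Dop i (Dop i (\<lambda>w. Rtilde n w (x \<circ> sref i))) u"
    by (rule Dop_cong[OF assms(1,3) eq])
  then show ?thesis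
    using True eq[OF assms(1)] Dop_square[OF Sym_imp_inj[OF assms(1)]] by simp
next
  case False
  then have "x i < x (Suc i)" using not_desc_asc assms by blast
  then show ?thesis
    using Rtilde_desc[OF assms(1) Sym_comp_sref[OF assms(2,3)] assms(3)] False by simp
qed

section \<open>Chains of transpositions involving a fixed position\<close>

definition chain :: "nat \<Rightarrow> perm \<Rightarrow> nat set \<Rightarrow> bool" where
  "chain m x A \<longleftrightarrow> (\<forall>a\<in>A. x a < x m) \<and> (\<forall>a\<in>A. \<forall>b\<in>A. a < b \<longrightarrow> x b < x a)"

text \<open>Cyclic predecessor in \<open>A \<union> {m}\<close>: the default \<open>m\<close> closes
  the cycle. This closed form, unlike a product, lets an element be inserted at any place.\<close>

definition prv :: "nat \<Rightarrow> nat set \<Rightarrow> nat \<Rightarrow> nat" where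
  "prv m A p = (if {a\<in>A. a < p} = {} then m else Max {a\<in>A. a < p})"

definition cyc :: "nat \<Rightarrow> nat set \<Rightarrow> perm" where
  "cyc m A p = (if p \<in> A \<or> p = m then prv m A p else p)"

text \<open>For \<open>A = {a\<^sub>1 < \<dots> < a\<^sub>k}\<close> below \<open>m\<close> this is \<open>x (a\<^sub>1 m) (a\<^sub>2 m) \<dots> (a\<^sub>k m)\<close>.\<close>

definition theta :: "nat \<Rightarrow> perm \<Rightarrow> nat set \<Rightarrow> perm" where
  "theta m x A = x \<circ> cyc m A"

lemma theta_empty [simp]: "theta m x {} = x"
  by (rule ext) (simp add: theta_def cyc_def prv_def)

lemma theta_other: "p \<notin> A \<Longrightarrow> p \<noteq> m \<Longrightarrow> theta m x A p = x p"
  by (simp add: theta_def cyc_def)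

lemma cyc_insert_min:
  assumes "k < m" "A \<subseteq> {Suc k..<m}"
  shows "cyc m (insert k A) = tp k m \<circ> cyc m A"
proof
  fix p
  have fin: "finite A" using assms(2) finite_subset by blast
  consider "p = k" | "p \<in> A \<or> p = m" | "p \<noteq> k" "p \<notin> A" "p \<noteq> m" by blast
  then show "cyc m (insert k A) p = (tp k m \<circ> cyc m A) p"
  proof cases
    case 1
    then have "{a \<in> insert k A. a < p} = {}" "p \<notin> A" using assms by auto
    then show ?thesis using 1 assms by (simp add: cyc_def prv_def)
  next
    case 2
    then have kp: "k < p" using assms by auto
    then have set: "{a \<in> insert k A. a < p} = insert k {a \<in> A. a < p}" by auto
    show ?thesis
    proof (cases "{a \<in> A. a < p} = {}")
      case True
      have "prv m (insert k A) p = k" "prv m A p = m"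
        unfolding prv_def set True by simp_all
      then show ?thesis using 2 by (simp add: cyc_def)
    next
      case False
      have "Max {a \<in> A. a < p} \<in> {a \<in> A. a < p}" using fin False by (intro Max_in) auto
      then have "k < Max {a \<in> A. a < p}" "Max {a \<in> A. a < p} < m" using assms by auto
      moreover have "prv m A p = Max {a \<in> A. a < p}"
        unfolding prv_def by (rule if_not_P[OF False])
      moreover have "prv m (insert k A) p = Max (insert k {a \<in> A. a < p})"
        unfolding prv_def set by simp
      moreover have "\<dots> = max k (Max {a \<in> A. a < p})"
        using fin by (intro Max_insert False) simp
      ultimately show ?thesis using 2 by (simp add: cyc_def)
    qed
  next
    case 3
    then show ?thesis by (simp add: cyc_def)
  qed
qed

lemma theta_insert_min:
  assumes "k < m" "A \<subseteq> {Suc k..<m}"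
  shows "theta m x (insert k A) = theta m (x \<circ> tp k m) A"
  by (simp add: theta_def cyc_insert_min[OF assms] comp_assoc)

text \<open>After the exchange the entry at \<open>m\<close> is \<open>x k\<close>, so being below
  the entry at \<open>m\<close> expresses that the later entries are below
  \<open>x k\<close>.\<close>

lemma chain_insert_min:
  assumes "k < m" "A \<subseteq> {Suc k..<m}"
  shows "chain m x (insert k A) \<longleftrightarrow> x k < x m \<and> chain m (x \<circ> tp k m) A"
proof -
  have "(x \<circ> tp k m) a = x a" if "a \<in> A" for a
    using that assms by (metis atLeastLessThan_iff comp_apply less_irrefl not_less_eq_eq
        order_refl subsetD transpose_apply_other)
  moreover have "k < a" if "a \<in> A" for a using that assms by auto
  ultimately show ?thesis
    unfolding chain_def by (auto; force)
qed

text \<open>Generating function of the ways in which the cluster at \<open>x\<close> reaches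
  \<open>v\<close>. The case \<open>k = 1\<close> enters \<open>Htilde\<close>; larger
  \<open>k\<close> serve downward induction through \<open>cc_step\<close>.\<close>

definition cc :: "nat \<Rightarrow> nat \<Rightarrow> perm \<Rightarrow> perm \<Rightarrow> int poly" where
  "cc m k x v = (\<Sum>A | A \<subseteq> {k..<m} \<and> chain m x A \<and> theta m x A = v. X ^ card A)"

lemma cc_base: "m \<le> k \<Longrightarrow> cc m k x v = (if x = v then 1 else 0)"
proof -
  assume "m \<le> k"
  then have "{A. A \<subseteq> {k..<m} \<and> chain m x A \<and> theta m x A = v} = (if x = v then {{}} else {})"
    by (auto simp: chain_def)
  then show ?thesis by (simp add: cc_def)
qed

lemma cc_step:
  assumes k: "k < m"
  shows "cc m k x v = cc m (Suc k) x v + (if x k < x m then X * cc m (Suc k) (x \<circ> tp k m) v else 0)"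
proof -
  define S where "S k x = {A. A \<subseteq> {k..<m} \<and> chain m x A \<and> theta m x A = v}" for k x
  have fin: "finite (S k x)" for k x
    by (rule finite_subset[of _ "Pow {k..<m}"]) (auto simp: S_def)
  let ?T = "if x k < x m then insert k ` S (Suc k) (x \<circ> tp k m) else {}"
  have dec: "S k x = S (Suc k) x \<union> ?T"
  proof (intro equalityI subsetI)
    fix A assume A: "A \<in> S k x"
    show "A \<in> S (Suc k) x \<union> ?T"
    proof (cases "k \<in> A")
      case True
      define B where "B = A - {k}"
      have B: "A = insert k B" "B \<subseteq> {Suc k..<m}"
        using A True by (auto simp: B_def S_def Suc_le_eq order_le_less)
      then show ?thesis
        using A chain_insert_min[OF k B(2)] theta_insert_min[OF k B(2)] by (auto simp: S_def)
    next
      case False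
      then have "A \<subseteq> {Suc k..<m}" using A by (auto simp: S_def Suc_le_eq order_le_less)
      then show ?thesis using A by (auto simp: S_def)
    qed
  next
    fix A assume A: "A \<in> S (Suc k) x \<union> ?T"
    show "A \<in> S k x"
    proof (cases "A \<in> S (Suc k) x")
      case True
      then show ?thesis by (auto simp: S_def)
    next
      case False
      then obtain B where B: "A = insert k B" "B \<in> S (Suc k) (x \<circ> tp k m)" "x k < x m"
        using A by (auto split: if_splits)
      then have B': "B \<subseteq> {Suc k..<m}" by (auto simp: S_def)
      then have "A \<subseteq> {k..<m}" using B k by auto
      then show ?thesis
        using B chain_insert_min[OF k B'] theta_insert_min[OF k B'] by (auto simp: S_def)
    qed
  qed
  have notin: "k \<notin> B" if "B \<in> S (Suc k) y" for B y using that by (auto simp: S_def)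
  have finB: "finite B" if "B \<in> S (Suc k) y" for B y
    using that finite_subset by (auto simp: S_def)
  have inj: "inj_on (insert k) (S (Suc k) (x \<circ> tp k m))"
    by (rule inj_onI) (metis insert_ident notin)
  have "(\<Sum>A\<in>insert k ` S (Suc k) (x \<circ> tp k m). X ^ card A)
      = (\<Sum>A\<in>S (Suc k) (x \<circ> tp k m). X * X ^ card A)"
    unfolding sum.reindex[OF inj]
    by (intro sum.cong refl) (simp only: comp_apply card_insert_disjoint[OF finB notin] power_Suc)
  moreover have "(\<Sum>A\<in>S k x. X ^ card A) = (\<Sum>A\<in>S (Suc k) x. X ^ card A) + (\<Sum>A\<in>?T. X ^ card A)"
    unfolding dec by (rule sum.union_disjoint) (use fin notin in \<open>auto\<close>)
  ultimately show ?thesis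
    unfolding cc_def S_def[symmetric] by (simp add: sum_distrib_left)
qed

lemma cc_nonzeroE:
  assumes "cc m k x v \<noteq> 0"
  obtains A where "A \<subseteq> {k..<m}" "chain m x A" "theta m x A = v"
proof -
  have "{A. A \<subseteq> {k..<m} \<and> chain m x A \<and> theta m x A = v} \<noteq> {}"
    using assms unfolding cc_def by (metis sum.empty)
  then show ?thesis using that by blast
qed

lemma cc_agree:
  assumes "cc m k x v \<noteq> 0" "p < k \<or> m < p" "p \<noteq> m"
  shows "x p = v p"
  using assms(1)
proof (rule cc_nonzeroE)
  fix A assume A: "A \<subseteq> {k..<m}" "chain m x A" "theta m x A = v"
  then have "p \<notin> A" using assms(2) by auto
  then show "x p = v p" using A(3) theta_other[OF _ assms(3), of A x] by auto
qed

lemma theta_last: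
  assumes "A \<subseteq> {k..<m}" "A \<noteq> {}" "chain m x A"
  shows "theta m x A m < x m"
proof -
  have fin: "finite A" using assms(1) finite_subset by blast
  have set: "{a \<in> A. a < m} = A" using assms(1) by auto
  have "Max A \<in> A" using fin assms(2) by simp
  then show ?thesis
    using assms by (simp add: theta_def cyc_def prv_def set chain_def)
qed

lemma cc_last:
  assumes "cc m k x v \<noteq> 0"
  shows "x = v \<or> v m < x m"
  using assms
proof (rule cc_nonzeroE)
  fix A assume "A \<subseteq> {k..<m}" "chain m x A" "theta m x A = v"
  then show ?thesis using theta_last[of A k m x] by (cases "A = {}") auto
qed

lemma cc_refl: "cc m k v v = 1"
proof -
  have "{A. A \<subseteq> {k..<m} \<and> chain m v A \<and> theta m v A = v} = {{}}"
    using theta_last[of _ k m v] by (auto simp: chain_def) (metis less_irrefl empty_iff)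
  then show ?thesis by (simp add: cc_def)
qed

lemma cc_sref:
  assumes "k \<le> m" "Suc i < k"
  shows "cc m k (x \<circ> sref i) (v \<circ> sref i) = cc m k x v"
  using assms
proof (induction k arbitrary: x rule: inc_induct)
  case base
  have "x \<circ> sref i = v \<circ> sref i \<longleftrightarrow> x = v" by (metis comp_sref_sref)
  then show ?case by (simp only: cc_base[OF order_refl])
next
  case (step k)
  have c: "x \<circ> sref i \<circ> tp k m = x \<circ> tp k m \<circ> sref i"
    by (rule ext) (use step in \<open>auto simp: sref_def transpose_def\<close>)
  have IH: "cc m (Suc k) (y \<circ> sref i) (v \<circ> sref i) = cc m (Suc k) y v" for y
    using step.prems by (intro step.IH) simp
  have "sref i k = k" "sref i m = m" using step by (auto simp: sref_other)
  then show ?case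
    unfolding cc_step[OF step(2)] c IH by simp
qed

text \<open>The counterpart of \<open>Dop_Rtilde\<close> for \<open>cc\<close>: it carries a descent
  of \<open>v\<close> over to \<open>x\<close>. Exchanges at positions before \<open>i\<close>
  commute with \<open>sref i\<close>, which reduces to \<open>k = i\<close>; there both sides are
  expanded over the positions \<open>i\<close> and \<open>i + 1\<close>.\<close>

lemma cc_desc:
  assumes "k \<le> i" "Suc i < m" "v (Suc i) < v i" "inj x"
  shows "cc m k x v = cc m k (x \<circ> sref i) (v \<circ> sref i)
    + (if x (Suc i) < x i then X * cc m k x (v \<circ> sref i) else 0)"
  using assms
proof (induction k arbitrary: x rule: inc_induct)
  case base
  define N where "N y = cc m (Suc (Suc i)) y v" for y
  have Ns: "cc m (Suc (Suc i)) y (v \<circ> sref i) = N (y \<circ> sref i)" for y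
    using cc_sref[of "Suc (Suc i)" m i "y \<circ> sref i" v] base by (simp add: N_def)
  \<comment> \<open>The remaining exchanges leave \<open>i\<close> and \<open>i + 1\<close> alone,
    so a permutation ascending there cannot reach \<open>v\<close>, which descends. This removes the
    unmatched terms in each order of \<open>x i\<close>, \<open>x (Suc i)\<close>,
    \<open>x m\<close>.\<close>
  have N0: "N y = 0" if "y i < y (Suc i)" for y
  proof (rule ccontr)
    assume "N y \<noteq> 0"
    then have "y i = v i" "y (Suc i) = v (Suc i)"
      using cc_agree[of m "Suc (Suc i)" y v i] cc_agree[of m "Suc (Suc i)" y v "Suc i"] base
      unfolding N_def by auto
    then show False using that base by simp
  qed
  have im: "i < m" "Suc i < m" using base(1) by simp_all
  have ne: "x i \<noteq> x (Suc i)" "x i \<noteq> x m" "x (Suc i) \<noteq> x m"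
    using inj_eq[OF \<open>inj x\<close>] im by simp_all
  have e1: "x \<circ> sref i \<circ> tp (Suc i) m \<circ> sref i = x \<circ> tp i m"
    and e2: "x \<circ> sref i \<circ> tp i m \<circ> sref i = x \<circ> tp (Suc i) m"
    and e4: "x \<circ> tp (Suc i) m \<circ> sref i = x \<circ> tp i m \<circ> tp (Suc i) m"
    and e3: "x \<circ> sref i \<circ> tp i m \<circ> tp (Suc i) m \<circ> sref i = x \<circ> tp (Suc i) m \<circ> tp i m"
    by (rule ext, use im in \<open>auto simp: sref_def transpose_def\<close>)+
  have mi: "sref i m = m" using im by (simp add: sref_other)
  note steps = cc_step[OF im(1)] cc_step[OF im(2)]
  note Z = N0[of "x \<circ> tp (Suc i) m \<circ> tp i m"] N0[of "x \<circ> sref i"]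
    N0[of "x \<circ> tp i m \<circ> tp (Suc i) m"] N0[of "x \<circ> tp i m \<circ> sref i"]
    N0[of "x \<circ> tp i m \<circ> tp (Suc i) m \<circ> sref i"]
  show ?case
    unfolding steps Ns N_def[symmetric] e1 e2 e3 e4
    using im ne Z mi
    by (cases "x i < x (Suc i)"; cases "x i < x m"; cases "x (Suc i) < x m")
       (simp_all add: algebra_simps)
next
  case (step k)
  have c: "x \<circ> sref i \<circ> tp k m = x \<circ> tp k m \<circ> sref i"
    by (rule ext) (use step in \<open>auto simp: sref_def transpose_def\<close>)
  have km: "k < m" using step by simp
  have "inj (x \<circ> tp k m)" using step by (simp add: inj_compose)
  have IH: "cc m (Suc k) y v = cc m (Suc k) (y \<circ> sref i) (v \<circ> sref i)
    + (if y (Suc i) < y i then X * cc m (Suc k) y (v \<circ> sref i) else 0)"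
    if "y = x \<or> y = x \<circ> tp k m" for y
  proof (rule step.IH)
    show "inj y" using that \<open>inj (x \<circ> tp k m)\<close> step.prems(3) by auto
  qed (use step.prems in simp_all)
  have "sref i k = k" "sref i m = m" using step by (auto simp: sref_other)
  moreover have "tp k m i = i" "tp k m (Suc i) = Suc i" using step by auto
  ultimately show ?case
    unfolding cc_step[OF km] c using IH[of x] IH[of "x \<circ> tp k m"]
    by (simp add: algebra_simps)
qed

section \<open>Decomposing \<open>Rtilde\<close> along a parabolic coset\<close>

text \<open>In contrast to the ideal in general, this set is stable under right multiplication by
  \<open>sref i\<close> for \<open>1 \<le> i\<close>, \<open>Suc i < m\<close>, as the reindexing of
  the sum requires.\<close>

definition Coset :: "nat \<Rightarrow> nat \<Rightarrow> perm \<Rightarrow> perm set" where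
  "Coset n m u = {x \<in> Sym n. \<forall>k\<ge>m. x k = u k}"

lemma finite_Coset: "finite (Coset n m u)"
  unfolding Coset_def using finite_Sym by simp

lemma Rtilde_at_last_0:
  assumes "\<And>k. k > m \<Longrightarrow> u k = w k" "u m < w m"
  shows "Rtilde n u w = 0"
  using bruhat_le_at_last[of n u w m] assms by (intro Rtilde_not_le) auto

lemma Sym_agree_image:
  assumes u: "u \<in> Sym n" and v: "v \<in> Sym n" and agree: "\<And>k. k > m \<Longrightarrow> u k = v k" and "k \<le> m"
  shows "\<exists>l\<le>m. v l = u k"
proof -
  obtain l where l: "v l = u k"
    using v unfolding Sym_def by (metis mem_Collect_eq permutes_surj surjD)
  have "l \<le> m"
  proof (rule ccontr)
    assume "\<not> l \<le> m"
    then have "u l = u k" using l agree by simp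
    then show False using Sym_inj[OF u] \<open>\<not> l \<le> m\<close> \<open>k \<le> m\<close> by simp
  qed
  then show ?thesis using l by blast
qed

text \<open>The terminal case, where \<open>v\<close> descends up to \<open>m\<close> only at
  \<open>m - 1\<close>. Unfolding that descent, the entry at \<open>m\<close> kills one of the two
  terms. For \<open>a = m - 1\<close> the other is the claim; otherwise
  \<open>v \<circ> tp a m\<close> is unfolded too, and the surviving terms match by induction on
  \<open>m\<close>.\<close>

lemma Rtilde_grassmannian:
  assumes "u \<in> Sym n" "v \<in> Sym n" "m \<le> n" "1 \<le> a" "a < m"
    and "\<And>p q. 1 \<le> p \<Longrightarrow> p < q \<Longrightarrow> q < m \<Longrightarrow> v p < v q" "v m < v a"
    and "\<And>k. k > m \<Longrightarrow> u k = v k" "u m = v a"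
  shows "Rtilde n u v = X * Rtilde n u (v \<circ> tp a m)"
  using assms
proof (induction m arbitrary: u v)
  case 0
  then show ?case by simp
next
  case (Suc i)
  note u = Suc.prems(1) and v = Suc.prems(2) and inc = Suc.prems(6)
    and agree = Suc.prems(8) and um = Suc.prems(9)
  have i: "i \<in> {1..<n}" using Suc.prems by auto
  have "v a \<le> v i"
  proof (cases "a = i")
    case False
    then have "a < i" using Suc.prems(5) by simp
    then show ?thesis using inc[of a i] Suc.prems(4) by simp
  qed simp
  then have vi: "v (Suc i) < v i" using Suc.prems(7) by simp
  have S: "u \<circ> sref i \<in> Sym n" "v \<circ> sref i \<in> Sym n"
    using u v i by (auto intro: Sym_comp_sref)
  have vmax: "v l \<le> v i" if "1 \<le> l" "l \<le> Suc i" for l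
    using inc[of l i] that vi by (cases "l < i"; cases "l = i") (auto simp: le_Suc_eq)
  have s_beyond: "sref i k = k" if "k > Suc i" for k using that by (simp add: sref_other)
  \<comment> \<open>The entries of \<open>u\<close> and \<open>v\<close> at positions
    \<open>1\<close> to \<open>Suc i\<close> form the same set, with maximum
    \<open>v i\<close>.\<close>
  have ui_le: "u i \<le> v i"
  proof -
    obtain l where l: "l \<le> Suc i" "v l = u i"
      using Sym_agree_image[OF u v, of "Suc i" i] agree by auto
    have "1 \<le> l" using l Sym_in[OF v, of l] Sym_in[OF u, of i] i by auto
    then show ?thesis using vmax l by metis
  qed
  have desc: "Rtilde n u v = Dop i (\<lambda>w. Rtilde n w (v \<circ> sref i)) u"
    by (rule Rtilde_desc[OF u v i vi])
  show ?case
  proof (cases "a = i")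
    case True
    then have "u i \<noteq> v i" using um Sym_inj[OF u, of i "Suc i"] by simp
    then have ui: "u i < v i" using ui_le by simp
    have z: "Rtilde n (u \<circ> sref i) (v \<circ> sref i) = 0"
      by (rule Rtilde_at_last_0[of "Suc i"]) (use agree ui in \<open>auto simp: s_beyond\<close>)
    have e: "v \<circ> tp a (Suc i) = v \<circ> sref i" by (simp only: True sref_def)
    have "u i < u (Suc i)" using ui um True by simp
    then show ?thesis by (simp only: e desc Dop_def z if_True add_0_left)
  next
    case False
    then have ai: "a < i" using Suc.prems by simp
    have va: "v a < v i" using inc[of a i] ai Suc.prems by simp
    have ta: "tp a (Suc i) i = i" using ai by simp
    define x where "x = v \<circ> tp a (Suc i)"
    have x: "x \<in> Sym n" "x (Suc i) < x i"
      unfolding x_def using Suc.prems va ta by (auto intro!: Sym_comp_tp)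
    have xb: "x k = v k" if "k > Suc i" for k
      using that ai by (simp add: x_def)
    have desc': "Rtilde n u x = Dop i (\<lambda>w. Rtilde n w (x \<circ> sref i)) u"
      by (rule Rtilde_desc[OF u x(1) i x(2)])
    have z1: "Rtilde n u (v \<circ> sref i) = 0"
      by (rule Rtilde_at_last_0[of "Suc i"]) (use agree um va in \<open>auto simp: s_beyond\<close>)
    have z2: "Rtilde n u (x \<circ> sref i) = 0"
      by (rule Rtilde_at_last_0[of "Suc i"])
        (use agree um va xb ta in \<open>auto simp: s_beyond x_def\<close>)
    have xs: "x \<circ> sref i = v \<circ> sref i \<circ> tp a i"
      unfolding x_def by (rule ext) (use ai in \<open>auto simp: sref_def transpose_def\<close>)
    \<comment> \<open>After the reflection, position \<open>Suc i\<close> holds \<open>u i\<close>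
      in the first arguments and \<open>v i\<close> in the second ones. Equality freezes it and
      allows induction; a smaller \<open>u i\<close> makes both sides zero.\<close>
    have "Rtilde n (u \<circ> sref i) (v \<circ> sref i) = X * Rtilde n (u \<circ> sref i) (x \<circ> sref i)"
    proof (cases "u i = v i")
      case True
      show ?thesis unfolding xs
      proof (rule Suc.IH)
        show "u \<circ> sref i \<in> Sym n" "v \<circ> sref i \<in> Sym n" by (rule S)+
        show "i \<le> n" "1 \<le> a" "a < i" using Suc.prems ai by auto
        show "(v \<circ> sref i) p < (v \<circ> sref i) q" if "1 \<le> p" "p < q" "q < i" for p q
          using inc[of p q] that by (simp add: sref_other)
        show "(v \<circ> sref i) i < (v \<circ> sref i) a" using ai Suc.prems by (simp add: sref_other)
        show "(u \<circ> sref i) k = (v \<circ> sref i) k" if "i < k" for k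
          using that True agree by (cases "k = Suc i") (auto simp: sref_other)
        show "(u \<circ> sref i) i = (v \<circ> sref i) a" using ai um by (simp add: sref_other)
      qed
    next
      case False
      then have ui: "u i < v i" using ui_le by simp
      have "Rtilde n (u \<circ> sref i) (v \<circ> sref i) = 0"
        by (rule Rtilde_at_last_0[of "Suc i"]) (use agree ui in \<open>auto simp: s_beyond\<close>)
      moreover have "Rtilde n (u \<circ> sref i) (x \<circ> sref i) = 0"
        by (rule Rtilde_at_last_0[of "Suc i"])
          (use agree ui xb ta in \<open>auto simp: s_beyond x_def\<close>)
      ultimately show ?thesis by simp
    qed
    then show ?thesis
      by (simp only: x_def[symmetric] desc desc' Dop_def z1 z2 mult_zero_right if_cancel add_0_right)
  qed
qed

lemma theta_Min:
  assumes "A \<subseteq> {k..<m}" "a \<in> A" "\<And>b. b \<in> A \<Longrightarrow> a \<le> b"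
  shows "theta m x A a = x m"
proof -
  have "{b \<in> A. b < a} = {}" using assms(3) by fastforce
  then have "prv m A a = m" unfolding prv_def by simp
  then show ?thesis using assms by (simp add: theta_def cyc_def)
qed

lemma prv_in:
  assumes "finite A" "a \<in> A" "a < b"
  shows "prv m A b \<in> A" "prv m A b < b"
proof -
  have ne: "{c \<in> A. c < b} \<noteq> {}" using assms by blast
  have "prv m A b = Max {c \<in> A. c < b}" unfolding prv_def by (rule if_not_P[OF ne])
  moreover have "Max {c \<in> A. c < b} \<in> {c \<in> A. c < b}" using assms(1) ne by (intro Max_in) auto
  ultimately show "prv m A b \<in> A" "prv m A b < b" by auto
qed

lemma theta_singleton: "a < m \<Longrightarrow> theta m x {a} = x \<circ> tp a m"
  using theta_insert_min[of a m "{}" x] by simp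

text \<open>If \<open>theta m x A = v\<close>, then \<open>v\<close> has the value
  \<open>x m\<close> at the least element of \<open>A\<close> and smaller values at the others. As
  \<open>v\<close> increases before \<open>m\<close>, there are no others.\<close>

lemma cc_grassmannian:
  assumes v: "inj v" and inc: "\<And>p q. k \<le> p \<Longrightarrow> p < q \<Longrightarrow> q < m \<Longrightarrow> v p < v q"
    and a: "k \<le> a" "a < m" "v m < v a" and xm: "x m = v a"
  shows "cc m k x v = (if x = v \<circ> tp a m then X else 0)"
proof -
  have "{A. A \<subseteq> {k..<m} \<and> chain m x A \<and> theta m x A = v} = (if x = v \<circ> tp a m then {{a}} else {})"
    (is "?S = ?T")
  proof (intro equalityI subsetI)
    fix A assume "A \<in> ?S"
    then have A: "A \<subseteq> {k..<m}" "chain m x A" "theta m x A = v" by auto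
    have fin: "finite A" using A(1) finite_subset by blast
    have "A \<noteq> {}" using A(3) a xm by auto
    define b where "b = Min A"
    have b: "b \<in> A" "\<And>c. c \<in> A \<Longrightarrow> b \<le> c" unfolding b_def using fin \<open>A \<noteq> {}\<close> by auto
    have vb: "v b = x m" using theta_Min[OF A(1) b, of x] A(3) by simp
    have "A = {b}"
    proof (rule ccontr)
      assume "A \<noteq> {b}"
      then obtain c where c: "c \<in> A" "c \<noteq> b" using b(1) by blast
      then have bc: "b < c" using b(2)[of c] by simp
      have "v c = x (prv m A c)" using A(3) c(1) by (auto simp: theta_def cyc_def)
      also have "\<dots> < x m" using prv_in[OF fin b(1) bc] A(2) by (simp add: chain_def)
      finally have "v c < v b" using vb by simp
      moreover have "v b < v c" using A(1) b c bc by (intro inc) auto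
      ultimately show False by simp
    qed
    moreover have "b = a" using vb xm inj_eq[OF v] by simp
    moreover have "x = v \<circ> tp a m" using A(3) \<open>A = {b}\<close> \<open>b = a\<close> theta_singleton[OF a(2), of x]
      by (metis comp_tp_tp)
    ultimately show "A \<in> ?T" by simp
  next
    fix A assume "A \<in> ?T"
    then have "x = v \<circ> tp a m" "A = {a}" by (auto split: if_splits)
    then show "A \<in> ?S" using a by (auto simp: theta_singleton chain_def)
  qed
  then show ?thesis by (simp add: cc_def)
qed

text \<open>Stated without \<open>u \<le> v\<close>, so that the induction hypothesis covers both
  \<open>u\<close> and \<open>u \<circ> sref i\<close> for a descent of \<open>v\<close> before
  \<open>m\<close>. Without such a descent, at most one \<open>x\<close> contributes.\<close>

lemma Rtilde_coset_decomposition: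
  assumes "u \<in> Sym n" "v \<in> Sym n" "m \<in> {1..n}" "\<And>k. k > m \<Longrightarrow> u k = v k"
  shows "Rtilde n u v = (\<Sum>x\<in>Coset n m u. Rtilde n u x * cc m 1 x v)"
  using assms
proof (induction "len n v" arbitrary: u v rule: less_induct)
  case less
  note u = less(2) and v = less(3) and m = less(4) and agree = less(5)
  show ?case
  proof (cases "\<exists>i. 1 \<le> i \<and> Suc i < m \<and> v (Suc i) < v i")
    case True
    then obtain i where im: "1 \<le> i" "Suc i < m" and vi: "v (Suc i) < v i" by blast
    have i: "i \<in> {1..<n}" using im m by auto
    have S: "u \<circ> sref i \<in> Sym n" "v \<circ> sref i \<in> Sym n"
      using u v i by (auto intro: Sym_comp_sref)
    have sk: "sref i k = k" if "k \<ge> m" for k using that im by (simp add: sref_other)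
    have C: "Coset n m (u \<circ> sref i) = Coset n m u"
      unfolding Coset_def by (auto simp: sk)
    have l: "len n (v \<circ> sref i) < len n v" using len_comp_sref_desc[OF i vi] by simp
    have IH: "Rtilde n w (v \<circ> sref i) = (\<Sum>x\<in>Coset n m u. Rtilde n w x * cc m 1 x (v \<circ> sref i))"
      if "w = u \<or> w = u \<circ> sref i" for w
    proof -
      have "w \<in> Sym n" "Coset n m w = Coset n m u" using that u S C by auto
      moreover have "w k = (v \<circ> sref i) k" if "k > m" for k
        using that \<open>w = u \<or> w = u \<circ> sref i\<close> agree sk[of k] by auto
      ultimately show ?thesis using less(1)[OF l _ S(2) m, of w] by auto
    qed
    have bij: "bij_betw (\<lambda>x. x \<circ> sref i) (Coset n m u) (Coset n m u)"
      by (rule bij_betw_byWitness[where f' = "\<lambda>x. x \<circ> sref i"])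
         (auto simp: Coset_def sk Sym_comp_sref[OF _ i])
    have "Rtilde n u v = Dop i (\<lambda>w. Rtilde n w (v \<circ> sref i)) u"
      by (rule Rtilde_desc[OF u v i vi])
    also have "\<dots> = (\<Sum>x\<in>Coset n m u. Dop i (\<lambda>w. Rtilde n w x) u * cc m 1 x (v \<circ> sref i))"
      unfolding Dop_def using IH[of u] IH[of "u \<circ> sref i"]
      by (simp add: sum_distrib_left sum.distrib[symmetric] algebra_simps)
    also have "\<dots> = (\<Sum>x\<in>Coset n m u. Rtilde n u (x \<circ> sref i) * cc m 1 x (v \<circ> sref i))
        + (\<Sum>x\<in>Coset n m u. Rtilde n u x * (if x (Suc i) < x i then X * cc m 1 x (v \<circ> sref i) else 0))"
      unfolding sum.distrib[symmetric]
    proof (rule sum.cong[OF refl])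
      fix x assume "x \<in> Coset n m u"
      then have "x \<in> Sym n" by (simp add: Coset_def)
      from Dop_Rtilde[OF u this i] show "Dop i (\<lambda>w. Rtilde n w x) u * cc m 1 x (v \<circ> sref i)
        = Rtilde n u (x \<circ> sref i) * cc m 1 x (v \<circ> sref i)
          + Rtilde n u x * (if x (Suc i) < x i then X * cc m 1 x (v \<circ> sref i) else 0)"
        by (simp only:) (simp add: algebra_simps)
    qed
    \<comment> \<open>Reindexing by \<open>x \<circ> sref i\<close> moves the reflection from
      \<open>Rtilde\<close> into \<open>cc\<close>, where \<open>cc_desc\<close> can be read from
      right to left.\<close>
    also have "(\<Sum>x\<in>Coset n m u. Rtilde n u (x \<circ> sref i) * cc m 1 x (v \<circ> sref i))
        = (\<Sum>x\<in>Coset n m u. Rtilde n u x * cc m 1 (x \<circ> sref i) (v \<circ> sref i))"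
      using sum.reindex_bij_betw[OF bij, of "\<lambda>x. Rtilde n u x * cc m 1 (x \<circ> sref i) (v \<circ> sref i)"]
      by (simp only: comp_sref_sref)
    also have "\<dots> + (\<Sum>x\<in>Coset n m u. Rtilde n u x * (if x (Suc i) < x i then X * cc m 1 x (v \<circ> sref i) else 0))
        = (\<Sum>x\<in>Coset n m u. Rtilde n u x * cc m 1 x v)"
      unfolding sum.distrib[symmetric]
    proof (rule sum.cong[OF refl])
      fix x assume "x \<in> Coset n m u"
      then have "inj x" unfolding Coset_def using Sym_imp_inj by blast
      from cc_desc[OF im(1,2) vi this] show "Rtilde n u x * cc m 1 (x \<circ> sref i) (v \<circ> sref i)
          + Rtilde n u x * (if x (Suc i) < x i then X * cc m 1 x (v \<circ> sref i) else 0)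
        = Rtilde n u x * cc m 1 x v"
        by (simp only: distrib_left)
    qed
    finally show ?thesis .
  next
    case False
    have step: "v p < v (Suc p)" if "1 \<le> p" "Suc p < m" for p
      using False that not_desc_asc[OF v] by blast
    have inc: "v p < v q" if "1 \<le> p" "p < q" "q < m" for p q
      using that(2,1,3)
    proof (induction p q rule: less_Suc_induct)
      case (1 p)
      then show ?case using step by simp
    next
      case (2 p q r)
      then show ?case by (meson less_trans less_imp_le order_trans)
    qed
    show ?thesis
    proof (cases "v m < u m")
      case False
      \<comment> \<open>A nonempty chain lowers the entry at \<open>m\<close>, so for
        \<open>u m \<le> v m\<close> only \<open>x = v\<close> can contribute.\<close>
      have neq: "Rtilde n u x * cc m 1 x v = 0" if "x \<in> Coset n m u" "x \<noteq> v" for x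
      proof -
        have "x m = u m" using that by (simp add: Coset_def)
        then have "cc m 1 x v = 0" using cc_last[of m 1 x v] False that(2) by auto
        then show ?thesis by simp
      qed
      show ?thesis
      proof (cases "u m = v m")
        case True
        have "v k = u k" if "k \<ge> m" for k using that True agree by (cases "k = m") auto
        then have vC: "v \<in> Coset n m u" using v by (simp add: Coset_def)
        have "(\<Sum>x\<in>Coset n m u. Rtilde n u x * cc m 1 x v)
            = (\<Sum>x\<in>{v}. Rtilde n u x * cc m 1 x v)"
          by (rule sum.mono_neutral_right) (use vC neq finite_Coset in auto)
        then show ?thesis by (simp add: cc_refl)
      next
        case neq': False
        then have "v \<notin> Coset n m u" by (auto simp: Coset_def)
        then have "(\<Sum>x\<in>Coset n m u. Rtilde n u x * cc m 1 x v) = 0"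
          using neq by (intro sum.neutral) metis
        moreover have "Rtilde n u v = 0"
          by (rule Rtilde_at_last_0[OF agree]) (use False neq' in auto)
        ultimately show ?thesis by simp
      qed
    next
      case True
      obtain a where a: "a \<le> m" "v a = u m" using Sym_agree_image[OF u v agree order_refl] by auto
      have "a \<noteq> m" using a True by auto
      then have am: "a < m" using a by simp
      have a1: "1 \<le> a" using Sym_in[OF v, of a] Sym_in[OF u, of m] a m by auto
      have va: "v m < v a" using a True by simp
      let ?x = "v \<circ> tp a m"
      have "?x \<in> Sym n" using v a1 am m by (intro Sym_comp_tp) auto
      moreover have "?x k = u k" if "k \<ge> m" for k
        using that am a agree by (cases "k = m") auto
      ultimately have xC: "?x \<in> Coset n m u" by (simp add: Coset_def)
      have "Rtilde n u v = X * Rtilde n u ?x"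
        by (rule Rtilde_grassmannian[OF u v _ a1 am inc va agree]) (use m a in auto)
      moreover have "(\<Sum>x\<in>Coset n m u. Rtilde n u x * cc m 1 x v)
          = (\<Sum>x\<in>Coset n m u. if x = ?x then Rtilde n u ?x * X else 0)"
      proof (rule sum.cong[OF refl])
        fix x assume "x \<in> Coset n m u"
        then have "x m = v a" using a by (simp add: Coset_def)
        from cc_grassmannian[where v = v and k = 1 and m = m and a = a and x = x, OF Sym_imp_inj[OF v] inc a1 am va this]
        show "Rtilde n u x * cc m 1 x v = (if x = ?x then Rtilde n u ?x * X else 0)" by simp
      qed
      moreover have "\<dots> = Rtilde n u ?x * X"
        using xC finite_Coset by (simp only: sum.delta if_True)
      ultimately show ?thesis by (simp only: mult.commute)
    qed
  qed
qed

section \<open>The clusters\<close>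

definition nxt :: "nat \<Rightarrow> nat set \<Rightarrow> nat \<Rightarrow> nat" where
  "nxt m A b = Min {a \<in> insert m A. b < a}"

lemma nxt_props:
  assumes "A \<subseteq> {1..<m}" "b < m"
  shows "nxt m A b \<in> insert m A" "b < nxt m A b" "nxt m A b \<le> m"
    and "\<And>a. a \<in> A \<Longrightarrow> b < a \<Longrightarrow> nxt m A b \<le> a"
proof -
  let ?S = "{a \<in> insert m A. b < a}"
  have fin: "finite ?S" using assms finite_subset[of A "{1..<m}"] by simp
  have ne: "?S \<noteq> {}" using assms by blast
  have "nxt m A b \<in> ?S" unfolding nxt_def by (rule Min_in[OF fin ne])
  then show "nxt m A b \<in> insert m A" "b < nxt m A b" by auto
  show "nxt m A b \<le> m" unfolding nxt_def by (rule Min_le[OF fin]) (use assms in simp)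
  show "nxt m A b \<le> a" if "a \<in> A" "b < a" for a
    unfolding nxt_def by (rule Min_le[OF fin]) (use that in simp)
qed

lemma nxt_insert_less:
  assumes "b < c"
  shows "nxt m (insert b A) c = nxt m A c"
proof -
  have "{a \<in> insert m (insert b A). c < a} = {a \<in> insert m A. c < a}" using assms by auto
  then show ?thesis by (simp only: nxt_def)
qed

lemma prv_cong: "{a \<in> A. a < p} = {a \<in> B. a < q} \<Longrightarrow> prv m A p = prv m B q"
  by (simp only: prv_def)

lemma prv_eqI:
  assumes "finite A" "a \<in> A" "a < p" "\<And>c. c \<in> A \<Longrightarrow> c < p \<Longrightarrow> c \<le> a"
  shows "prv m A p = a"
proof -
  have "prv m A p = Max {c \<in> A. c < p}"
    unfolding prv_def by (rule if_not_P) (use assms in blast)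
  also have "\<dots> = a" using assms by (intro Max_eqI) auto
  finally show ?thesis .
qed

text \<open>The new element \<open>b\<close> takes over the predecessor of its successor
  \<open>nxt m A b\<close>, whose predecessor becomes \<open>b\<close>; the rest of the cycle is
  unchanged. The factor stands on the right, so it gives an edge of the Bruhat graph, as (HC3)
  demands.\<close>

lemma cyc_insert:
  assumes A: "A \<subseteq> {1..<m}" and b: "b < m" "b \<notin> A"
  shows "cyc m (insert b A) = cyc m A \<circ> tp b (nxt m A b)"
proof
  fix p
  define d where "d = nxt m A b"
  note d = nxt_props[OF A b(1), folded d_def]
  have fin: "finite A" using A finite_subset by blast
  have "d \<noteq> b" using d(2) by simp
  consider "p = b" | "p = d" | "p \<in> insert m A" "p < b" | "p \<in> insert m A" "p \<noteq> d" "b < p"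
    | "p \<noteq> b" "p \<noteq> d" "p \<notin> insert m A"
    by linarith
  then have "cyc m (insert b A) p = (cyc m A \<circ> tp b d) p"
  proof cases
    case 1
    have "{a \<in> insert b A. a < b} = {a \<in> A. a < d}"
      using d(2,4) b(2) by (auto simp: not_less) (metis le_neq_implies_less not_le)
    then have "prv m (insert b A) b = prv m A d" by (rule prv_cong)
    then show ?thesis using 1 d(1) by (auto simp: cyc_def)
  next
    case 2
    have "prv m (insert b A) d = b"
      by (rule prv_eqI) (use fin d(2,4) in \<open>auto simp: not_less[symmetric]\<close>)
    then show ?thesis using 2 d(1) b \<open>d \<noteq> b\<close> by (auto simp: cyc_def)
  next
    case 3
    then have "{a \<in> insert b A. a < p} = {a \<in> A. a < p}" by auto
    then have "prv m (insert b A) p = prv m A p" by (rule prv_cong)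
    then show ?thesis using 3 d(2) by (auto simp: cyc_def)
  next
    case 4
    then have "d < p" using d(3) d(4)[of p] by auto
    moreover have "p \<le> m" using 4 A by auto
    ultimately have dA: "d \<in> A" using d(1) by auto
    define e where "e = prv m A p"
    have e: "e \<in> A" "e < p" unfolding e_def using prv_in[OF fin dA \<open>d < p\<close>] by auto
    have emax: "c \<le> e" if "c \<in> A" "c < p" for c
    proof -
      have "{c \<in> A. c < p} \<noteq> {}" using that by blast
      then have "e = Max {c \<in> A. c < p}" unfolding e_def prv_def by (rule if_not_P)
      then show ?thesis using that fin by simp
    qed
    have "prv m (insert b A) p = e"
      by (rule prv_eqI) (use fin e emax emax[OF dA \<open>d < p\<close>] d(2) in auto)
    then show ?thesis using 4 e_def by (auto simp: cyc_def)
  next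
    case 5
    then show ?thesis by (auto simp: cyc_def)
  qed
  then show "cyc m (insert b A) p = (cyc m A \<circ> tp b (nxt m A b)) p" by (simp only: d_def)
qed

lemma theta_insert:
  assumes "A \<subseteq> {1..<m}" "b < m" "b \<notin> A"
  shows "theta m x (insert b A) = theta m x A \<circ> tp b (nxt m A b)"
  unfolding theta_def cyc_insert[OF assms] by (simp only: comp_assoc)

text \<open>At \<open>nxt m A b\<close>, \<open>theta m x A\<close> has either the entry
  \<open>x m\<close> or the entry of \<open>x\<close> at an element of \<open>A\<close> before
  \<open>b\<close>; both exceed \<open>x b\<close> in a chain.\<close>

lemma theta_nxt_greater:
  assumes A: "A \<subseteq> {1..<m}" and b: "b < m" "b \<notin> A" and ch: "chain m x (insert b A)"
  shows "x b < theta m x A (nxt m A b)"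
proof -
  define d where "d = nxt m A b"
  note d = nxt_props[OF A b(1), folded d_def]
  have fin: "finite A" using A finite_subset by blast
  have th: "theta m x A d = x (prv m A d)" using d(1) by (auto simp: theta_def cyc_def)
  have "x b < x (prv m A d)"
  proof (cases "{a \<in> A. a < d} = {}")
    case True
    then have "prv m A d = m" unfolding prv_def by (rule if_P)
    then show ?thesis using ch by (auto simp: chain_def)
  next
    case False
    then obtain a where "a \<in> A" "a < d" by blast
    note e = prv_in[OF fin this, of m]
    have "prv m A d < b" using e d(4)[of "prv m A d"] b(2) by (metis linorder_neqE_nat not_le)
    then show ?thesis using e ch by (auto simp: chain_def)
  qed
  then show ?thesis using th by (simp only: d_def)
qed

lemma theta_Sym:
  assumes "x \<in> Sym n" "m \<in> {1..n}" "A \<subseteq> {1..<m}"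
  shows "theta m x A \<in> Sym n"
proof -
  have "finite A" using assms finite_subset by blast
  then show ?thesis using assms(3)
  proof (induction A rule: finite_induct)
    case empty
    then show ?case using assms by simp
  next
    case (insert b A)
    then have A: "A \<subseteq> {1..<m}" and b: "1 \<le> b" "b < m" by auto
    note d = nxt_props[OF A b(2)]
    show ?case
      unfolding theta_insert[OF A b(2) insert(2)]
      using insert A b d assms(2) by (intro Sym_comp_tp) auto
  qed
qed

lemma theta_insert_bedge:
  assumes x: "x \<in> Sym n" and m: "m \<in> {1..n}" and A: "A \<subseteq> {1..<m}" and b: "b \<in> {1..<m}" "b \<notin> A"
    and ch: "chain m x (insert b A)"
  shows "bedge n (theta m x A) (theta m x (insert b A))"
proof -
  have bm: "b < m" using b by simp
  note d = nxt_props[OF A bm]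
  have "theta m x A b = x b" by (rule theta_other) (use b in auto)
  then have "theta m x A b < theta m x A (nxt m A b)"
    using theta_nxt_greater[OF A bm b(2) ch] by simp
  then show ?thesis
    unfolding theta_insert[OF A bm b(2)]
    using theta_Sym[OF x m A] b m d by (intro bedge_comp_tp) auto
qed

lemma chain_subset: "chain m x A \<Longrightarrow> B \<subseteq> A \<Longrightarrow> chain m x B"
  unfolding chain_def by blast

lemma theta_mono:
  assumes x: "x \<in> Sym n" and m: "m \<in> {1..n}" and A: "A \<subseteq> {1..<m}" and ch: "chain m x A"
    and BA: "B \<subseteq> A"
  shows "bruhat_le n (theta m x B) (theta m x A)"
proof -
  have fin: "finite A" using A finite_subset by blast
  have "bruhat_le n (theta m x B) (theta m x (B \<union> C))" if "finite C" "C \<subseteq> A" for C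
    using that
  proof (induction C rule: finite_induct)
    case empty
    then show ?case using theta_Sym[OF x m, of B] BA A by (auto intro: bruhat_le_refl)
  next
    case (insert c C)
    then have IH: "bruhat_le n (theta m x B) (theta m x (B \<union> C))" by simp
    show ?case
    proof (cases "c \<in> B")
      case True
      then show ?thesis using IH by (simp add: insert_absorb)
    next
      case False
      have "bedge n (theta m x (B \<union> C)) (theta m x (insert c (B \<union> C)))"
        by (rule theta_insert_bedge[OF x m])
          (use insert False BA A chain_subset[OF ch] in auto)
      then show ?thesis using IH bedge_imp_le bruhat_le_trans by (metis Un_insert_right)
    qed
  qed
  from this[OF fin order_refl] show ?thesis using BA by (simp add: Un_absorb1)
qed

text \<open>Relative to \<open>x\<close>, the two neighbours raise the rank on the rectangles
  \<open>[k, m)\<close> by \<open>(x k, x m]\<close> and \<open>[a, m)\<close> by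
  \<open>(x a, x m]\<close>. The product raises it by one on their union, so its rank function is
  the pointwise maximum.\<close>

lemma bruhat_le_join:
  assumes x: "x \<in> Sym n" and m: "m \<le> n" and k: "1 \<le> k" "k < a" "a < m"
    and less: "x a < x k" "x k < x m"
    and le: "bruhat_le n (x \<circ> tp k m) v" "bruhat_le n (x \<circ> tp a m) v"
  shows "bruhat_le n (x \<circ> tp k m \<circ> tp a m) v"
proof -
  have km: "k < m" "1 \<le> a" using k by auto
  have "rk (x \<circ> tp k m \<circ> tp a m) p q \<le> rk v p q" for p q
  proof -
    note l = bruhat_le_rk[OF le(1), of p q] bruhat_le_rk[OF le(2), of p q]
    have "rk (x \<circ> tp k m \<circ> tp a m) p q \<le> max (rk (x \<circ> tp k m) p q) (rk (x \<circ> tp a m) p q)"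
      unfolding rk_comp_tp[OF km(2) k(3)] rk_comp_tp[OF k(1) km(1)]
      using k less by (cases "a \<le> p"; cases "q \<le> x a"; cases "q \<le> x k"; cases "q \<le> x m") auto
    then show ?thesis using l by linarith
  qed
  moreover have "x \<circ> tp k m \<circ> tp a m \<in> Sym n"
    using x m k by (intro Sym_comp_tp) auto
  ultimately show ?thesis using bruhat_le_Sym[OF le(1)] by (simp add: bruhat_le_iff_rk)
qed

lemma theta_le:
  assumes "x \<in> Sym n" "m \<in> {1..n}" "A \<subseteq> {1..<m}" "chain m x A" "bruhat_le n x v"
    and "\<And>a. a \<in> A \<Longrightarrow> bruhat_le n (x \<circ> tp a m) v"
  shows "bruhat_le n (theta m x A) v"
proof -
  have "finite A" using assms(3) finite_subset by blast
  then show ?thesis using assms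
  proof (induction A arbitrary: x rule: finite_linorder_min_induct)
    case empty
    then show ?case by simp
  next
    case (insert b A)
    have b: "b < m" "1 \<le> b" and A: "A \<subseteq> {1..<m}" using insert.prems(3) by auto
    have A': "A \<subseteq> {Suc b..<m}"
    proof
      fix a assume a: "a \<in> A"
      then have "b < a" using insert.hyps(2) by blast
      then show "a \<in> {Suc b..<m}" using A a by auto
    qed
    have ch: "x b < x m" "chain m (x \<circ> tp b m) A"
      using chain_insert_min[OF b(1) A'] insert.prems(4) by auto
    show ?case
      unfolding theta_insert_min[OF b(1) A']
    proof (rule insert.IH)
      show "x \<circ> tp b m \<in> Sym n" using insert.prems b by (intro Sym_comp_tp) auto
      show "m \<in> {1..n}" "A \<subseteq> {1..<m}" "chain m (x \<circ> tp b m) A" by fact+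
      show "bruhat_le n (x \<circ> tp b m) v" by (rule insert.prems(6)) simp
      show "bruhat_le n (x \<circ> tp b m \<circ> tp a m) v" if "a \<in> A" for a
      proof (rule bruhat_le_join)
        show "x \<in> Sym n" "1 \<le> b" "x b < x m" by fact+
        show "m \<le> n" using insert.prems(2) by simp
        show "b < a" "a < m" using that A' by auto
        then show "x a < x b" using insert.prems(4) that by (auto simp: chain_def)
        show "bruhat_le n (x \<circ> tp b m) v" "bruhat_le n (x \<circ> tp a m) v"
          by (rule insert.prems(6), use that in simp)+
      qed
    qed
  qed
qed

text \<open>Two steps \<open>z \<rightarrow> z (b d)\<close> and \<open>z \<rightarrow> z (c d')\<close> have a common upper neighbour \<open>w\<close> only if the sets of
  positions where \<open>w\<close> differs from either of them jointly cover the positions where they differ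
  from each other.\<close>

lemma theta_diamond:
  assumes x: "x \<in> Sym n" and m: "m \<in> {1..n}" and Z: "Z \<subseteq> {1..<m}"
    and b: "b \<in> {1..<m}" "b \<notin> Z" and c: "c \<in> {1..<m}" "c \<notin> Z" and bc: "b < c"
    and chb: "chain m x (insert b Z)" and chc: "chain m x (insert c Z)"
    and w1: "bedge n (theta m x (insert b Z)) w" and w2: "bedge n (theta m x (insert c Z)) w"
  shows "chain m x (insert c (insert b Z)) \<and> theta m x (insert c (insert b Z)) = w"
proof -
  define z where "z = theta m x Z"
  define d d' where "d = nxt m Z b" and "d' = nxt m Z c"
  have bm: "b < m" "c < m" using b c by auto
  note D = nxt_props[OF Z bm(1), folded d_def] and D' = nxt_props[OF Z bm(2), folded d'_def]
  have z: "z \<in> Sym n" unfolding z_def by (rule theta_Sym[OF x m Z])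
  note inj = Sym_inj[OF z]
  have e1: "theta m x (insert b Z) = z \<circ> tp b d"
    unfolding z_def d_def by (rule theta_insert[OF Z bm(1) b(2)])
  have e2: "theta m x (insert c Z) = z \<circ> tp c d'"
    unfolding z_def d'_def by (rule theta_insert[OF Z bm(2) c(2)])
  have "nxt m (insert b Z) c = d'" unfolding d'_def by (rule nxt_insert_less[OF bc])
  then have e3: "theta m x (insert c (insert b Z)) = z \<circ> tp b d \<circ> tp c d'"
    using theta_insert[of "insert b Z" m c x] Z b bm bc c(2) e1 by auto
  have zb: "z b = x b" "z c = x c"
    unfolding z_def using b c by (auto intro!: theta_other)
  have lz: "len n z < len n w"
    using theta_insert_bedge[OF x m Z b chb] w1 by (simp add: bedge_def z_def)
  obtain p q where pq: "p < q" "(z \<circ> tp b d) p < (z \<circ> tp b d) q" "w = z \<circ> tp b d \<circ> tp p q"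
    using w1 unfolding e1 bedge_iff by blast
  obtain r s where rs: "r < s" "w = z \<circ> tp c d' \<circ> tp r s"
    using w2 unfolding e2 bedge_iff by blast
  have cover: "k \<in> {p, q, r, s}" if "(z \<circ> tp b d) k \<noteq> (z \<circ> tp c d') k" for k
  proof (rule ccontr)
    assume "k \<notin> {p, q, r, s}"
    then have "tp p q k = k" "tp r s k = k" by auto
    then have "(z \<circ> tp b d \<circ> tp p q) k = (z \<circ> tp b d) k"
      "(z \<circ> tp c d' \<circ> tp r s) k = (z \<circ> tp c d') k"
      by (simp_all only: comp_apply)
    then show False using that pq(3) rs(2) by metis
  qed
  have chI: "chain m x (insert c (insert b Z))" if "x c < x b"
    using chb chc that bc unfolding chain_def by auto
  show ?thesis
  proof (cases "c < d")
    case True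
    \<comment> \<open>No element of \<open>Z\<close> lies between \<open>b\<close> and
      \<open>c\<close>, so both steps have the same partner \<open>d\<close>, and only three
      positions are involved.\<close>
    have dd: "d' = d"
      using D' D True bc c by (metis insert_iff le_antisym less_trans order_less_imp_le)
    have zd: "z b < z d"
      using theta_nxt_greater[OF Z bm(1) b(2) chb] zb by (simp add: z_def d_def)
    have zd': "z c < z d"
      using theta_nxt_greater[OF Z bm(2) c(2) chc] zb dd by (simp add: z_def d'_def)
    have dis: "b \<noteq> c" "b \<noteq> d" "c \<noteq> d" using bc True by auto
    have "b \<in> {p, q, r, s}" "c \<in> {p, q, r, s}" "d \<in> {p, q, r, s}"
      by (rule cover, use zd zd' dis inj dd in force)+
    moreover have "k \<in> {r, s}" if "k \<in> {p, q}" "k \<notin> {b, c, d}" for k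
    proof (rule ccontr)
      assume "k \<notin> {r, s}"
      then have "tp r s k = k" by auto
      then have "w k = z k" using that dd unfolding rs(2) by auto
      moreover have "w k \<noteq> z k"
      proof -
        have "w k = (z \<circ> tp b d) (tp p q k)" by (simp add: pq(3))
        moreover have "tp p q k \<noteq> k" using that pq(1) by auto
        moreover have "(z \<circ> tp b d) k = z k" using that by auto
        ultimately show ?thesis using Sym_inj[OF bedge_Sym(1)[OF w1[unfolded e1]]] by metis
      qed
      ultimately show False by simp
    qed
    \<comment> \<open>A point of \<open>{p, q}\<close> outside \<open>{b, c, d}\<close> would also
      be \<open>r\<close> or \<open>s\<close>, leaving at most two points of
      \<open>{p, q, r, s}\<close> to cover \<open>b\<close>, \<open>c\<close>,
      \<open>d\<close>.\<close>
    ultimately have "p \<in> {b, c, d}" "q \<in> {b, c, d}"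
      using dis pq(1) rs(1) by (smt (verit) insert_iff singletonD)+
    \<comment> \<open>After the first step, \<open>b\<close> holds the largest of the three entries.
      An ascent among these positions is thus \<open>(c, d)\<close> with \<open>z c < z b\<close>,
      which is the missing chain condition.\<close>
    then have "p = c \<and> q = d \<and> z c < z b"
      using pq(1,2) bc True zd zd' by auto
    then show ?thesis using chI zb e3 pq(3) dd by simp
  next
    case False
    \<comment> \<open>Here \<open>d\<close> separates \<open>b\<close> from \<open>c\<close>: the
      chain condition follows by transitivity through \<open>d\<close>, and the four positions are
      distinct.\<close>
    then have "d \<in> Z" "d < c" using D c bm by (auto simp: not_less order_le_less)
    then have xcb: "x c < x b" using chb chc D(2) unfolding chain_def by (meson insertI1 insertI2 less_trans)
    have dis: "distinct [b, d, c, d']" using D(2) D'(2) \<open>d < c\<close> by auto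
    have sub: "{b, d, c, d'} \<subseteq> {p, q, r, s}"
    proof
      fix k assume "k \<in> {b, d, c, d'}"
      then show "k \<in> {p, q, r, s}" by (intro cover) (use dis inj in auto)
    qed
    have c4: "card {b, d, c, d'} = 4" using dis by simp
    have le4: "card {p, q, r, s} \<le> 4" using card_length[of "[p, q, r, s]"] by simp
    have eq: "{b, d, c, d'} = {p, q, r, s}"
      by (rule card_seteq[OF _ sub]) (use c4 le4 in auto)
    then have "card (set [p, q, r, s]) = length [p, q, r, s]" using c4 by simp
    then have dis': "distinct [p, q, r, s]" by (rule card_distinct)
    \<comment> \<open>As \<open>p\<close> is outside \<open>{r, s}\<close>, \<open>w p\<close> can
      be read off from both descriptions of \<open>w\<close>. This pairs \<open>p\<close> with
      \<open>q\<close> as \<open>b\<close> with \<open>d\<close>, which would lead back to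
      \<open>z\<close>, or as \<open>c\<close> with \<open>d'\<close>.\<close>
    then have "tp r s p = p" by auto
    then have wp: "w p = (z \<circ> tp c d') p" unfolding rs(2) by simp
    have "w p = (z \<circ> tp b d) q" unfolding pq(3) by simp
    with wp have "tp c d' p = tp b d q" using inj by simp
    moreover have "p \<in> {b, d, c, d'}" "p \<noteq> q" unfolding eq using dis' by auto
    ultimately have "p = b \<and> q = d \<or> p = d \<and> q = b \<or> p = c \<and> q = d' \<or> p = d' \<and> q = c"
      using dis by (auto simp: transpose_def split: if_splits)
    then consider "tp p q = tp b d" | "tp p q = tp c d'" using transpose_commute by metis
    then show ?thesis
    proof cases
      case 1
      then have "w = z" unfolding pq(3) by simp
      then show ?thesis using lz by simp
    next
      case 2
      then show ?thesis using e3 pq(3) chI[OF xcb] by simp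
    qed
  qed
qed

section \<open>The standard order ideal\<close>

text \<open>Going down from \<open>v\<close>: exchange \<open>v m\<close> with the last earlier entry in the range \<open>(v m, c]\<close>
  until the entry \<open>c\<close> has moved to position \<open>m\<close>.\<close>

lemma coset_max_step:
  assumes v: "v \<in> Sym n" and m: "m \<in> {1..n}" and a: "1 \<le> a" "a < m" "v m < v a" "v a \<le> c"
    and last: "\<And>b. a < b \<Longrightarrow> b < m \<Longrightarrow> \<not> (v m < v b \<and> v b \<le> c)"
    and le: "bruhat_le n x v" and xm: "x m = c" and agree: "\<And>k. k > m \<Longrightarrow> x k = v k"
  shows "bruhat_le n x (v \<circ> tp a m)"
proof -
  have x: "x \<in> Sym n" using bruhat_le_Sym[OF le] by simp
  have total: "rk x m q = rk v m q" for q
  proof -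
    have "(\<Sum>i\<in>{m<..n}. of_bool (q \<le> x i)) = (\<Sum>i\<in>{m<..n}. of_bool (q \<le> v i) :: int)"
      by (intro sum.cong) (auto simp: agree)
    then show ?thesis using rk_split[OF x, of m q] rk_split[OF v, of m q] m by simp
  qed
  have "rk x p q \<le> rk (v \<circ> tp a m) p q" for p q
  proof (cases "a \<le> p \<and> p < m \<and> v m < q \<and> q \<le> v a")
    case False
    then have "rk (v \<circ> tp a m) p q = rk v p q"
      using a by (auto simp: rk_comp_tp)
    then show ?thesis using bruhat_le_rk[OF le] by simp
  next
    case True
    \<comment> \<open>At positions \<open>p + 1\<close> to \<open>m\<close>, \<open>v\<close> has no
      value in \<open>[q, c]\<close> by the choice of \<open>a\<close>, whereas \<open>x\<close> has
      \<open>c\<close> at \<open>m\<close>. Since the ranks at \<open>m\<close> agree, this gives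
      the unit of slack that the exchange uses up.\<close>
    define s where "s w r = (\<Sum>i\<in>{p<..m}. of_bool (r \<le> w i) :: int)" for w :: perm and r
    have split: "rk w m r = rk w p r + s w r" for w r
      unfolding s_def using True by (intro rk_diff) simp
    have "s v q = s v (Suc c)"
      unfolding s_def
    proof (intro sum.cong refl)
      fix i assume i: "i \<in> {p<..m}"
      show "of_bool (q \<le> v i) = (of_bool (Suc c \<le> v i) :: int)"
      proof (cases "i = m")
        case False
        then show ?thesis using last[of i] i True a by (auto simp: not_le)
      qed (use True a in auto)
    qed
    moreover have "s x (Suc c) + 1 \<le> s x q"
    proof -
      have set: "{p<..m} = insert m {p<..<m}" using True by auto
      have "(\<Sum>i\<in>{p<..<m}. of_bool (Suc c \<le> x i) :: int) \<le> (\<Sum>i\<in>{p<..<m}. of_bool (q \<le> x i))"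
        by (intro sum_mono) (use True a in auto)
      then show ?thesis
        unfolding s_def set using True a xm by (simp del: sum_of_bool_eq)
    qed
    moreover have "s v (Suc c) \<le> s x (Suc c)"
      using bruhat_le_rk[OF le, of p "Suc c"] total[of "Suc c"] split[of x "Suc c"] split[of v "Suc c"]
      by linarith
    ultimately have "rk x p q + 1 \<le> rk v p q"
      using total[of q] split[of x q] split[of v q] by linarith
    then show ?thesis using a True by (simp add: rk_comp_tp)
  qed
  then show ?thesis
    using x v a m by (simp add: bruhat_le_iff_rk Sym_comp_tp)
qed

lemma coset_max_exists:
  assumes "v \<in> Sym n" "m \<in> {1..n}" "1 \<le> a0" "a0 \<le> m" "v a0 = c" "v m \<le> c"
  shows "\<exists>z. bruhat_le n z v \<and> z m = c \<and> (\<forall>k>m. z k = v k) \<and>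
    (\<forall>x. bruhat_le n x v \<longrightarrow> x m = c \<longrightarrow> (\<forall>k>m. x k = v k) \<longrightarrow> bruhat_le n x z)"
  using assms
proof (induction "c - v m" arbitrary: v a0 rule: less_induct)
  case less
  note v = less(2) and m = less(3)
  show ?case
  proof (cases "v m = c")
    case True
    then show ?thesis using v bruhat_le_refl by blast
  next
    case False
    then have vc: "v m < c" using less by simp
    let ?S = "{a \<in> {1..<m}. v m < v a \<and> v a \<le> c}"
    have "a0 \<noteq> m" using False less by auto
    then have ne: "a0 \<in> ?S" using less vc by auto
    define a where "a = Max ?S"
    have "a \<in> ?S" unfolding a_def by (rule Max_in) (use ne in auto)
    then have a: "1 \<le> a" "a < m" "v m < v a" "v a \<le> c" by auto
    have last: "\<not> (v m < v b \<and> v b \<le> c)" if "a < b" "b < m" for b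
    proof
      assume "v m < v b \<and> v b \<le> c"
      then have "b \<in> ?S" using that a by auto
      then have "b \<le> a" unfolding a_def by (intro Max_ge) auto
      then show False using that by simp
    qed
    define v' where "v' = v \<circ> tp a m"
    have v': "v' \<in> Sym n" "v' m = v a" "v' a = v m"
      unfolding v'_def using v a m by (auto intro!: Sym_comp_tp)
    have v'k: "v' k = v k" if "k > m" for k using that a by (simp add: v'_def)
    have "bedge n v' (v' \<circ> tp a m)"
      by (rule bedge_comp_tp[OF v'(1)]) (use a m v' in auto)
    then have le: "bruhat_le n v' v" unfolding v'_def by (simp add: bedge_imp_le)
    have "\<exists>a1. 1 \<le> a1 \<and> a1 \<le> m \<and> v' a1 = c"
    proof (cases "a0 = a")
      case True
      then show ?thesis using v' less m by (intro exI[of _ m]) auto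
    next
      case False
      then show ?thesis using \<open>a0 \<noteq> m\<close> less by (intro exI[of _ a0]) (auto simp: v'_def)
    qed
    then obtain a1 where "1 \<le> a1" "a1 \<le> m" "v' a1 = c" by blast
    moreover have "c - v' m < c - v m" "v' m \<le> c" using v' a by auto
    ultimately obtain z where z: "bruhat_le n z v'" "z m = c" "\<forall>k>m. z k = v' k"
      "\<And>x. bruhat_le n x v' \<Longrightarrow> x m = c \<Longrightarrow> \<forall>k>m. x k = v' k \<Longrightarrow> bruhat_le n x z"
      using less(1)[of v' a1] v' m by blast
    have "bruhat_le n x z" if "bruhat_le n x v" "x m = c" "\<forall>k>m. x k = v k" for x
    proof (rule z(4))
      show "bruhat_le n x v'"
        unfolding v'_def by (rule coset_max_step[OF v m a last that(1,2)]) (use that in auto)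
    qed (use that v'k in auto)
    moreover have "bruhat_le n z v" using z le bruhat_le_trans by blast
    ultimately show ?thesis using z(2,3) v'k by auto
  qed
qed

section \<open>The ideal inside a fixed interval\<close>

locale last_difference =
  fixes n :: nat and u v :: perm and m :: nat
  assumes u: "u \<in> Sym n" and v: "v \<in> Sym n" and uv: "bruhat_le n u v" and m: "m \<in> {1..n}"
    and agree: "\<And>k. k > m \<Longrightarrow> u k = v k" and differ: "u m \<noteq> v m"
begin

definition I :: "perm set" where
  "I = {x \<in> interval n u v. x m = u m}"

lemma intervalD:
  assumes "x \<in> interval n u v"
  shows "x \<in> Sym n" "bruhat_le n u x" "bruhat_le n x v"
  using assms by (auto simp: interval_def)

lemma intervalI: "bruhat_le n u x \<Longrightarrow> bruhat_le n x v \<Longrightarrow> x \<in> interval n u v"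
  using bruhat_le_Sym by (auto simp: interval_def)

lemma interval_agree: "x \<in> interval n u v \<Longrightarrow> k > m \<Longrightarrow> x k = u k"
  by (rule bruhat_le_agree_between[OF _ _ agree]) (auto dest: intervalD)

lemma interval_antimono_last:
  assumes "x \<in> interval n u v" "y \<in> interval n u v" "bruhat_le n x y"
  shows "y m \<le> x m"
  by (rule bruhat_le_at_last[OF assms(3)]) (simp add: interval_agree[OF assms(1)] interval_agree[OF assms(2)])

lemma u_in: "u \<in> interval n u v"
  using u uv by (auto intro: intervalI bruhat_le_refl)

lemma v_in: "v \<in> interval n u v"
  using v uv by (auto intro: intervalI bruhat_le_refl)

lemma interval_le_last: "x \<in> interval n u v \<Longrightarrow> x m \<le> u m"
  using interval_antimono_last[OF u_in] intervalD by blast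

lemma I_proper: "I \<subset> interval n u v"
proof
  show "I \<subseteq> interval n u v" by (auto simp: I_def)
  have "v \<notin> I" using differ by (simp add: I_def)
  then show "I \<noteq> interval n u v" using v_in by blast
qed

text \<open>Within the interval the entry at \<open>m\<close> can only decrease upwards. Below
  \<open>z\<close> it is therefore squeezed between \<open>z m = u m\<close> and
  \<open>u m\<close>.\<close>

lemma I_eq_interval: "\<exists>z\<in>interval n u v. I = interval n u z"
proof -
  obtain a where a: "a \<le> m" "v a = u m" using Sym_agree_image[OF u v agree order_refl] by auto
  have "1 \<le> a" using Sym_in[OF v, of a] Sym_in[OF u, of m] a m by auto
  moreover have "v m \<le> u m" using interval_le_last[OF v_in] .
  ultimately obtain z where z: "bruhat_le n z v" "z m = u m" "\<And>k. k > m \<Longrightarrow> z k = v k"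
    and max: "\<And>x. bruhat_le n x v \<Longrightarrow> x m = u m \<Longrightarrow> \<forall>k>m. x k = v k \<Longrightarrow> bruhat_le n x z"
    using coset_max_exists[OF v m _ a(1,2)] by blast
  have "bruhat_le n u z" by (rule max) (use uv agree in auto)
  then have zin: "z \<in> interval n u v" using z intervalI by blast
  have "I = interval n u z"
  proof (intro equalityI subsetI)
    fix x assume x: "x \<in> I"
    then have xi: "x \<in> interval n u v" "x m = u m" by (auto simp: I_def)
    have "bruhat_le n x z"
      by (rule max) (use intervalD[OF xi(1)] xi interval_agree agree in auto)
    then show "x \<in> interval n u z" using intervalD[OF xi(1)] by (auto simp: interval_def)
  next
    fix x assume "x \<in> interval n u z"
    then have x: "bruhat_le n u x" "bruhat_le n x z" by (auto simp: interval_def)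
    then have xi: "x \<in> interval n u v" using z bruhat_le_trans intervalI by blast
    have "z m \<le> x m" by (rule interval_antimono_last[OF xi zin x(2)])
    then show "x \<in> I" using xi z interval_le_last[OF xi] by (auto simp: I_def)
  qed
  then show ?thesis using zin by blast
qed

lemma notin_I_up:
  assumes "x \<in> interval n u v" "y \<in> interval n u v" "bedge n x y" "x \<notin> I"
  shows "y \<notin> I"
proof -
  have "y m \<le> x m" by (rule interval_antimono_last) (use assms bedge_imp_le in auto)
  moreover have "x m < u m" using assms interval_le_last[of x] by (auto simp: I_def)
  ultimately show ?thesis by (auto simp: I_def)
qed

text \<open>Leaving the ideal changes the entry at \<open>m\<close>, and the partner of
  \<open>m\<close> cannot lie beyond it, where entries are frozen.\<close>

lemma bedge_leaves_I:
  assumes "x \<in> I" "y \<in> interval n u v - I" "bedge n x y"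
  obtains a where "1 \<le> a" "a < m" "x a < x m" "y = x \<circ> tp a m"
proof -
  have x: "x \<in> Sym n" using assms bedge_Sym by blast
  obtain a b where ab: "a \<in> {1..n}" "b \<in> {1..n}" "a < b" "x a < x b" "y = x \<circ> tp a b"
    using assms(3) unfolding bedge_iff by blast
  have "y m \<noteq> x m" using assms by (auto simp: I_def)
  then have "m = a \<or> m = b" using ab by (metis comp_apply transpose_apply_other)
  moreover have "m \<noteq> a"
  proof
    assume "m = a"
    then have "m < b" using ab(3) by simp
    moreover have "x \<in> interval n u v" "y \<in> interval n u v" using assms(1,2) by (auto simp: I_def)
    ultimately have "y b = x b" by (simp only: interval_agree)
    then show False using ab by simp
  qed
  ultimately show ?thesis using that ab by auto
qed

text \<open>The complement of the ideal is closed upwards, so a single missing vertex is the top.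
  Then \<open>x2\<close> and \<open>x3\<close> both arise from \<open>x4\<close> by moving the value
  \<open>u m\<close> back to position \<open>m\<close>, and coincide.\<close>

lemma I_diamond_closed: "diamond_closed n u v I"
  unfolding diamond_closed_def
proof (intro conjI allI impI)
  show "I \<subseteq> interval n u v" by (auto simp: I_def)
  fix x1 x2 x3 x4
  assume d: "diamond n u v x1 x2 x3 x4" and card: "3 \<le> card ({x1, x2, x3, x4} \<inter> I)"
  let ?S = "{x1, x2, x3, x4}"
  have dis: "distinct [x1, x2, x3, x4]" and int: "?S \<subseteq> interval n u v"
    and e: "bedge n x1 x2" "bedge n x2 x4" "bedge n x1 x3" "bedge n x3 x4"
    using d by (auto simp: diamond_def)
  have two: False if "p \<in> ?S" "q \<in> ?S" "p \<noteq> q" "p \<notin> I" "q \<notin> I" for p q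
  proof -
    have "card ?S = 4" using dis by simp
    then have "card (?S - {p, q}) = 2" using that by (subst card_Diff_subset) auto
    moreover have "card (?S \<inter> I) \<le> card (?S - {p, q})" by (rule card_mono) (use that in auto)
    ultimately show False using card by simp
  qed
  have up: "q \<notin> I" if "p \<in> ?S" "q \<in> ?S" "bedge n p q" "p \<notin> I" for p q
    by (rule notin_I_up[of p q]) (use that int in auto)
  have 1: "x1 \<in> I" using two[of x1 x2] up[of x1 x2] e dis by auto
  have 2: "x2 \<in> I" using two[of x2 x4] up[of x2 x4] e dis by auto
  have 3: "x3 \<in> I" using two[of x3 x4] up[of x3 x4] e dis by auto
  have 4: "x4 \<in> I"
  proof (rule ccontr)
    assume "x4 \<notin> I"
    then have x4: "x4 \<in> interval n u v - I" using int by auto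
    obtain a where a: "x4 = x2 \<circ> tp a m" using bedge_leaves_I[OF 2 x4 e(2)] .
    obtain b where b: "x4 = x3 \<circ> tp b m" using bedge_leaves_I[OF 3 x4 e(4)] .
    have "x4 a = u m" using a 2 by (simp add: I_def)
    moreover have "x4 b = u m" using b 3 by (simp add: I_def)
    moreover have "x4 \<in> Sym n" using x4 intervalD(1) by blast
    ultimately have "a = b" using Sym_inj[of x4 n a b] by simp
    then have "x2 \<circ> tp a m = x3 \<circ> tp a m" using a b by simp
    then have "x2 = x3" by (simp only: comp_tp_eq_iff)
    then show False using dis by simp
  qed
  show "?S \<subseteq> I" using 1 2 3 4 by simp
qed

section \<open>Cluster maps on antichains\<close>

definition idx :: "perm \<Rightarrow> perm set \<Rightarrow> nat set" where
  "idx x Y = {a \<in> {1..<m}. x \<circ> tp a m \<in> Y}"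

definition Theta :: "perm \<Rightarrow> perm set \<Rightarrow> perm" where
  "Theta x Y = theta m x (idx x Y)"

abbreviation fan :: "perm \<Rightarrow> nat \<Rightarrow> perm" where
  "fan x a \<equiv> x \<circ> tp a m"

lemma I_Sym: "x \<in> I \<Longrightarrow> x \<in> Sym n"
  by (auto simp: I_def interval_def)

lemma inj_fan:
  assumes "x \<in> Sym n"
  shows "inj_on (fan x) A"
proof (rule inj_onI)
  fix a b assume "fan x a = fan x b"
  then have "fan x a m = fan x b m" by (rule arg_cong)
  then show "a = b" using Sym_inj[OF assms] by simp
qed

lemma idx_image:
  assumes "x \<in> Sym n" "A \<subseteq> {1..<m}"
  shows "idx x (fan x ` A) = A"
  using inj_onD[OF inj_fan[OF assms(1), of UNIV]] assms(2) unfolding idx_def by blast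

lemma mem_Ycal_iff:
  assumes "x \<in> I"
  shows "y \<in> Ycal n u v I x \<longleftrightarrow>
    (\<exists>a\<in>{1..<m}. x a < x m \<and> bruhat_le n (fan x a) v \<and> y = fan x a)"
proof
  assume "y \<in> Ycal n u v I x"
  then have y: "y \<in> interval n u v - I" "bedge n x y" by (auto simp: Ycal_def)
  obtain a where "1 \<le> a" "a < m" "x a < x m" "y = fan x a" using bedge_leaves_I[OF assms y] .
  then show "\<exists>a\<in>{1..<m}. x a < x m \<and> bruhat_le n (fan x a) v \<and> y = fan x a"
    using y intervalD(3)[of y] by auto
next
  assume "\<exists>a\<in>{1..<m}. x a < x m \<and> bruhat_le n (fan x a) v \<and> y = fan x a"
  then obtain a where a: "a \<in> {1..<m}" "x a < x m" "bruhat_le n y v" "y = fan x a" by blast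
  have e: "bedge n x y" unfolding a(4) by (rule bedge_comp_tp[OF I_Sym[OF assms]]) (use a m in auto)
  have "bruhat_le n u y"
    using assms bedge_imp_le[OF e] bruhat_le_trans intervalD(2)[of x] unfolding I_def by blast
  then have "y \<in> interval n u v" using a intervalI by blast
  moreover have "y \<notin> I" using a assms by (auto simp: I_def)
  ultimately show "y \<in> Ycal n u v I x" using e by (simp add: Ycal_def)
qed

text \<open>The element \<open>fan x a\<close> raises the rank of \<open>x\<close> on the rectangle
  \<open>[a, m)\<close> by \<open>(x a, x m]\<close>. For \<open>a < b\<close>, the rectangles are
  nested if \<open>x a < x b\<close> and incomparable otherwise.\<close>

lemma fan_antichain_iff:
  assumes x: "x \<in> Sym n" and A: "A \<subseteq> {1..<m}" and less: "\<And>a. a \<in> A \<Longrightarrow> x a < x m"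
  shows "bantichain n (fan x ` A) \<longleftrightarrow> chain m x A"
proof
  assume anti: "bantichain n (fan x ` A)"
  have "x b < x a" if ab: "a \<in> A" "b \<in> A" "a < b" for a b
  proof (rule ccontr)
    assume "\<not> x b < x a"
    then have xab: "x a < x b" using Sym_inj[OF x, of a b] ab(3) by auto
    have lt: "1 \<le> a" "1 \<le> b" "a < m" "b < m" using A ab by auto
    have "rk (fan x b) p q \<le> rk (fan x a) p q" for p q
      unfolding rk_comp_tp[OF lt(1,3)] rk_comp_tp[OF lt(2,4)]
      using ab xab less[of b] by auto
    moreover have "fan x a \<in> Sym n" "fan x b \<in> Sym n"
      using x lt m by (auto intro!: Sym_comp_tp)
    ultimately have "bruhat_le n (fan x b) (fan x a)" by (simp add: bruhat_le_iff_rk)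
    moreover have "fan x b \<noteq> fan x a"
      by (simp only: inj_eq[OF inj_fan[OF x]]) (use ab in simp)
    ultimately show False
      using anti[unfolded bantichain_def, rule_format, OF imageI[OF ab(2)] imageI[OF ab(1)]] by blast
  qed
  then show "chain m x A" using less by (auto simp: chain_def)
next
  assume ch: "chain m x A"
  have ord: "\<not> bruhat_le n (fan x a) (fan x b) \<and> \<not> bruhat_le n (fan x b) (fan x a)"
    if ab: "a \<in> A" "b \<in> A" "a < b" for a b
  proof -
    have lt: "1 \<le> a" "1 \<le> b" "a < m" "b < m" using A ab by auto
    have xs: "x b < x a" "x a < x m" "x b < x m" using ch ab by (auto simp: chain_def)
    \<comment> \<open>The point \<open>(a, x m)\<close> lies only in the rectangle of
      \<open>a\<close>, and \<open>(b, x a)\<close> only in that of \<open>b\<close>.\<close>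
    have "\<not> rk (fan x a) a (x m) \<le> rk (fan x b) a (x m)"
      unfolding rk_comp_tp[OF lt(1,3)] rk_comp_tp[OF lt(2,4)] using ab lt xs by simp
    moreover have "\<not> rk (fan x b) b (x a) \<le> rk (fan x a) b (x a)"
      unfolding rk_comp_tp[OF lt(1,3)] rk_comp_tp[OF lt(2,4)] using ab lt xs by simp
    ultimately show ?thesis using bruhat_le_rk by blast
  qed
  show "bantichain n (fan x ` A)"
    unfolding bantichain_def
  proof (intro ballI impI)
    fix y y' assume "y \<in> fan x ` A" "y' \<in> fan x ` A" "y \<noteq> y'"
    then obtain a b where ab: "a \<in> A" "b \<in> A" "a \<noteq> b" "y = fan x a" "y' = fan x b" by blast
    then show "\<not> bruhat_le n y y'" using ord[of a b] ord[of b a] by (metis linorder_neqE_nat)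
  qed
qed

lemma mem_Acal_iff:
  assumes x: "x \<in> I"
  shows "Y \<in> Acal n u v I x \<longleftrightarrow> (\<exists>A. A \<subseteq> {1..<m} \<and> chain m x A
    \<and> (\<forall>a\<in>A. bruhat_le n (fan x a) v) \<and> Y = fan x ` A)"
proof
  assume "Y \<in> Acal n u v I x"
  then have Y: "Y \<subseteq> Ycal n u v I x" "bantichain n Y" by (auto simp: Acal_def)
  let ?E = "{a \<in> {1..<m}. x a < x m \<and> bruhat_le n (fan x a) v}"
  have "Y \<subseteq> fan x ` ?E"
  proof
    fix y assume "y \<in> Y"
    then have "y \<in> Ycal n u v I x" using Y by blast
    then show "y \<in> fan x ` ?E" using mem_Ycal_iff[OF x] by blast
  qed
  then obtain A where A: "A \<subseteq> ?E" "Y = fan x ` A" by (auto simp: subset_image_iff)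
  then have "A \<subseteq> {1..<m}" "\<And>a. a \<in> A \<Longrightarrow> x a < x m" "\<forall>a\<in>A. bruhat_le n (fan x a) v" by blast+
  with A Y fan_antichain_iff[OF I_Sym[OF x]]
  show "\<exists>A. A \<subseteq> {1..<m} \<and> chain m x A
    \<and> (\<forall>a\<in>A. bruhat_le n (fan x a) v) \<and> Y = fan x ` A" by blast
next
  assume "\<exists>A. A \<subseteq> {1..<m} \<and> chain m x A
    \<and> (\<forall>a\<in>A. bruhat_le n (fan x a) v) \<and> Y = fan x ` A"
  then obtain A where A: "A \<subseteq> {1..<m}" "chain m x A" "\<forall>a\<in>A. bruhat_le n (fan x a) v"
    "Y = fan x ` A" by blast
  have less: "x a < x m" if "a \<in> A" for a using A(2) that by (auto simp: chain_def)
  have "Y \<subseteq> Ycal n u v I x"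
  proof
    fix y assume "y \<in> Y"
    then obtain a where a: "a \<in> A" "y = fan x a" using A(4) by blast
    then have "a \<in> {1..<m}" "x a < x m" "bruhat_le n (fan x a) v" using A less by blast+
    then show "y \<in> Ycal n u v I x" using mem_Ycal_iff[OF x] a(2) by blast
  qed
  moreover have "bantichain n Y"
    unfolding A(4) using fan_antichain_iff[OF I_Sym[OF x] A(1) less] A(2) by blast
  ultimately show "Y \<in> Acal n u v I x" by (simp add: Acal_def)
qed

lemma AcalE:
  assumes "x \<in> I" "Y \<in> Acal n u v I x"
  obtains A where "A \<subseteq> {1..<m}" "chain m x A" "\<forall>a\<in>A. bruhat_le n (fan x a) v"
    "Y = fan x ` A" "Theta x Y = theta m x A" "card Y = card A"
proof -
  obtain A where A: "A \<subseteq> {1..<m}" "chain m x A" "\<forall>a\<in>A. bruhat_le n (fan x a) v" "Y = fan x ` A"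
    using iffD1[OF mem_Acal_iff[OF assms(1)] assms(2)] by blast
  have "Theta x Y = theta m x A"
    unfolding Theta_def A(4) idx_image[OF I_Sym[OF assms(1)] A(1)] ..
  moreover have "card Y = card A"
    unfolding A(4) by (rule card_image[OF inj_fan[OF I_Sym[OF assms(1)]]])
  ultimately show ?thesis using that A by blast
qed

lemma strong_cluster_Theta:
  assumes x: "x \<in> I"
  shows "strong_cluster n u v I x (Theta x)"
  unfolding strong_cluster_def
proof (intro conjI ballI allI impI)
  note xS = I_Sym[OF x]
  have xi: "x \<in> interval n u v" using x by (simp add: I_def)
  show "Theta x Y \<in> interval n u v" if Y: "Y \<in> Acal n u v I x" for Y
  proof -
    obtain A where A: "A \<subseteq> {1..<m}" "chain m x A"
      "\<forall>a\<in>A. bruhat_le n (fan x a) v" "Y = fan x ` A"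
      "Theta x Y = theta m x A" "card Y = card A"
      by (rule AcalE[OF x Y])
    have "bruhat_le n (theta m x A) v"
      by (rule theta_le[OF xS m A(1,2) intervalD(3)[OF xi] A(3)[rule_format]])
    moreover have "bruhat_le n x (theta m x A)"
      using theta_mono[OF xS m A(1,2), of "{}"] by simp
    ultimately show ?thesis
      unfolding A(5) using intervalD(2)[OF xi] bruhat_le_trans intervalI by blast
  qed
  show "Theta x {} = x" by (simp add: Theta_def idx_def)
  show "Theta x {y} = y" if y: "y \<in> Ycal n u v I x" for y
  proof -
    obtain a where a: "a \<in> {1..<m}" "y = fan x a" using iffD1[OF mem_Ycal_iff[OF x] y] by blast
    then have "idx x {y} = {a}" using idx_image[OF xS, of "{a}"] by simp
    then show ?thesis using a theta_singleton[of a m x] by (simp add: Theta_def)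
  qed
  show "bedge n (Theta x Y1) (Theta x Y2)"
    if Y1: "Y1 \<in> Acal n u v I x" and Y2: "Y2 \<in> Acal n u v I x"
      and sub: "Y1 \<subseteq> Y2 \<and> card (Y2 - Y1) = 1" for Y1 Y2
  proof -
    obtain A where A: "A \<subseteq> {1..<m}" "chain m x A"
      "\<forall>a\<in>A. bruhat_le n (fan x a) v" "Y1 = fan x ` A"
      "Theta x Y1 = theta m x A" "card Y1 = card A"
      by (rule AcalE[OF x Y1])
    obtain B where B: "B \<subseteq> {1..<m}" "chain m x B"
      "\<forall>a\<in>B. bruhat_le n (fan x a) v" "Y2 = fan x ` B"
      "Theta x Y2 = theta m x B" "card Y2 = card B"
      by (rule AcalE[OF x Y2])
    have AB: "A \<subseteq> B"
      using sub inj_image_subset_iff[OF inj_fan[OF xS, of UNIV]] unfolding A(4) B(4) by simp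
    have "Y2 - Y1 = fan x ` (B - A)"
      unfolding A(4) B(4) by (rule image_set_diff[OF inj_fan[OF xS], symmetric])
    then have "card (B - A) = 1" using sub card_image[OF inj_fan[OF xS], of "B - A"] by simp
    then obtain b where b: "B - A = {b}" by (rule card_1_singletonE)
    then have eq: "B = insert b A" and bA: "b \<notin> A" "b \<in> {1..<m}" using AB B(1) by blast+
    show ?thesis
      unfolding A(5) B(5) eq by (rule theta_insert_bedge[OF xS m A(1) bA(2,1)]) (use B eq in simp)
  qed
  have HC4: "bantichain n (Y \<union> Y') \<and> Theta x (Y \<union> Y') = w"
    if Y: "Y \<in> Acal n u v I x" and Y': "Y' \<in> Acal n u v I x"
      and h: "card Y = card (Y \<inter> Y') + 1 \<and> card Y' = card (Y \<inter> Y') + 1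
        \<and> diamond n u v (Theta x (Y \<inter> Y')) (Theta x Y) (Theta x Y') w" for Y Y' w
  proof -
    obtain A where A: "A \<subseteq> {1..<m}" "chain m x A"
      "\<forall>a\<in>A. bruhat_le n (fan x a) v" "Y = fan x ` A"
      "Theta x Y = theta m x A" "card Y = card A"
      by (rule AcalE[OF x Y])
    obtain B where B: "B \<subseteq> {1..<m}" "chain m x B"
      "\<forall>a\<in>B. bruhat_le n (fan x a) v" "Y' = fan x ` B"
      "Theta x Y' = theta m x B" "card Y' = card B"
      by (rule AcalE[OF x Y'])
    have finA: "finite A" "finite B" using A(1) B(1) finite_subset by blast+
    define Z where "Z = A \<inter> B"
    have YZ: "Y \<inter> Y' = fan x ` Z"
      unfolding A(4) B(4) Z_def by (rule image_Int[OF inj_fan[OF xS], symmetric])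
    then have cZ: "card (Y \<inter> Y') = card Z" using card_image[OF inj_fan[OF xS], of Z] by simp
    have "card (A - Z) = 1" "card (B - Z) = 1"
      using h cZ A(6) B(6) finA by (auto simp: Z_def card_Diff_subset_Int Int_commute Int_left_commute)
    then obtain b c where bc: "A - Z = {b}" "B - Z = {c}" by (metis card_1_singletonE)
    have AZ: "A = insert b Z" "B = insert c Z" "b \<notin> Z" "c \<notin> Z" "b \<in> {1..<m}" "c \<in> {1..<m}"
      and ZZ: "Z \<subseteq> {1..<m}"
      using bc A(1) B(1) unfolding Z_def by blast+
    have "b \<noteq> c" using AZ unfolding Z_def by blast
    have e: "bedge n (theta m x (insert b Z)) w" "bedge n (theta m x (insert c Z)) w"
      using h unfolding diamond_def A(5) B(5) AZ(1,2) by blast+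
    have ch: "chain m x (insert b Z)" "chain m x (insert c Z)" using A(2) B(2) AZ by simp_all
    have res: "chain m x (A \<union> B) \<and> theta m x (A \<union> B) = w"
    proof (cases "b < c")
      case True
      have "A \<union> B = insert c (insert b Z)" using AZ by blast
      then show ?thesis
        using theta_diamond[OF xS m ZZ AZ(5,3,6,4) True ch e] by simp
    next
      case False
      then have "c < b" using \<open>b \<noteq> c\<close> by simp
      have "A \<union> B = insert b (insert c Z)" using AZ by blast
      then show ?thesis
        using theta_diamond[OF xS m ZZ AZ(6,4,5,3) \<open>c < b\<close> ch(2,1) e(2,1)] by simp
    qed
    have YY: "Y \<union> Y' = fan x ` (A \<union> B)" unfolding A(4) B(4) by blast
    have ABm: "A \<union> B \<subseteq> {1..<m}" using A B by blast
    have "bantichain n (Y \<union> Y')"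
      unfolding YY using fan_antichain_iff[OF xS ABm] res by (auto simp: chain_def)
    moreover have "Theta x (Y \<union> Y') = w"
      unfolding Theta_def YY idx_image[OF xS ABm] using res by simp
    ultimately show ?thesis by blast
  qed
  show "bantichain n (Y \<union> Y')" "Theta x (Y \<union> Y') = w"
    if "Y \<in> Acal n u v I x" "Y' \<in> Acal n u v I x"
      "card Y = card (Y \<inter> Y') + 1 \<and> card Y' = card (Y \<inter> Y') + 1
        \<and> diamond n u v (Theta x (Y \<inter> Y')) (Theta x Y) (Theta x Y') w" for Y Y' w
    using HC4[OF that] by blast+
qed

lemma strong_hcd_I: "strong_hcd n u v I Theta"
  unfolding strong_hcd_def using I_eq_interval I_diamond_closed strong_cluster_Theta by blast

section \<open>Comparison with \<open>Htilde\<close>\<close>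

lemma monom_eq_X_power: "monom 1 k = X ^ k"
  by (simp add: X_def monom_altdef)

text \<open>Chains correspond to antichains through \<open>fan x\<close>. Their neighbours lie below
  \<open>v\<close> automatically when \<open>theta m x A = v\<close>, since \<open>theta\<close> is
  monotone in the set.\<close>

lemma cluster_sum:
  assumes x: "x \<in> I"
  shows "(\<Sum>Y \<in> {Y \<in> Acal n u v I x. Theta x Y = v}. monom 1 (card Y) * Rtilde n u x)
    = Rtilde n u x * cc m 1 x v"
proof -
  note xS = I_Sym[OF x]
  let ?C = "{A. A \<subseteq> {1..<m} \<and> chain m x A \<and> theta m x A = v}"
  have "{Y \<in> Acal n u v I x. Theta x Y = v} = (\<lambda>A. fan x ` A) ` ?C"
  proof (intro equalityI subsetI)
    fix Y assume "Y \<in> {Y \<in> Acal n u v I x. Theta x Y = v}"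
    then have Y: "Y \<in> Acal n u v I x" "Theta x Y = v" by auto
    obtain A where "A \<subseteq> {1..<m}" "chain m x A"
      "\<forall>a\<in>A. bruhat_le n (fan x a) v" "Y = fan x ` A"
      "Theta x Y = theta m x A" "card Y = card A"
      by (rule AcalE[OF x Y(1)])
    then show "Y \<in> (\<lambda>A. fan x ` A) ` ?C" using Y(2) by auto
  next
    fix Y assume "Y \<in> (\<lambda>A. fan x ` A) ` ?C"
    then obtain A where A: "A \<subseteq> {1..<m}" "chain m x A" "theta m x A = v" "Y = fan x ` A" by auto
    have "bruhat_le n (fan x a) v" if "a \<in> A" for a
    proof -
      have "a < m" using that A(1) by auto
      then show ?thesis
        using theta_mono[OF xS m A(1,2), of "{a}"] that A(3) by (simp only: theta_singleton) simp
    qed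
    then have "Y \<in> Acal n u v I x" using mem_Acal_iff[OF x] A by blast
    moreover have "Theta x Y = v" unfolding Theta_def A(4) idx_image[OF xS A(1)] by (rule A(3))
    ultimately show "Y \<in> {Y \<in> Acal n u v I x. Theta x Y = v}" by simp
  qed
  moreover have "inj_on (\<lambda>A. fan x ` A) ?C"
    by (rule inj_onI) (use inj_image_eq_iff[OF inj_fan[OF xS]] in blast)
  ultimately have "(\<Sum>Y \<in> {Y \<in> Acal n u v I x. Theta x Y = v}. monom 1 (card Y) * Rtilde n u x)
      = (\<Sum>A \<in> ?C. monom 1 (card (fan x ` A)) * Rtilde n u x)"
    by (simp only: sum.reindex comp_def)
  also have "\<dots> = (\<Sum>A \<in> ?C. Rtilde n u x * X ^ card A)"
    by (intro sum.cong refl)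
       (simp only: card_image[OF inj_fan[OF xS]] monom_eq_X_power mult.commute)
  also have "\<dots> = Rtilde n u x * cc m 1 x v"
    by (simp only: cc_def sum_distrib_left)
  finally show ?thesis .
qed

text \<open>In the sum over the coset, a nonzero \<open>Rtilde n u x\<close> forces
  \<open>u \<le> x\<close> and a nonzero \<open>cc m 1 x v\<close> forces \<open>x \<le> v\<close>;
  the terms outside the ideal thus vanish.\<close>

lemma Rtilde_eq_Htilde: "Rtilde n u v = Htilde n u v I Theta"
proof -
  have sub: "I \<subseteq> Coset n m u"
  proof
    fix x assume x: "x \<in> I"
    have "x k = u k" if "k \<ge> m" for k
      using that x interval_agree[of x k] by (cases "k = m") (auto simp: I_def)
    then show "x \<in> Coset n m u" using I_Sym[OF x] by (simp add: Coset_def)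
  qed
  have zero: "Rtilde n u x * cc m 1 x v = 0" if "x \<in> Coset n m u - I" for x
  proof (rule ccontr)
    assume "Rtilde n u x * cc m 1 x v \<noteq> 0"
    then have nz: "Rtilde n u x \<noteq> 0" "cc m 1 x v \<noteq> 0" by auto
    have x: "x \<in> Sym n" "x m = u m" using that by (auto simp: Coset_def)
    have "bruhat_le n u x" using nz(1) Rtilde_not_le by blast
    moreover have "bruhat_le n x v"
      using nz(2)
    proof (rule cc_nonzeroE)
      fix A assume "A \<subseteq> {1..<m}" "chain m x A" "theta m x A = v"
      then show ?thesis using theta_mono[OF x(1) m, of A "{}"] by simp
    qed
    ultimately have "x \<in> I" using x intervalI by (simp add: I_def)
    then show False using that by simp
  qed
  have "Rtilde n u v = (\<Sum>x\<in>Coset n m u. Rtilde n u x * cc m 1 x v)"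
    by (rule Rtilde_coset_decomposition[OF u v m agree])
  also have "\<dots> = (\<Sum>x\<in>I. Rtilde n u x * cc m 1 x v)"
    by (rule sum.mono_neutral_right) (use sub zero finite_Coset in auto)
  also have "\<dots> = Htilde n u v I Theta"
    unfolding Htilde_def by (intro sum.cong refl) (simp only: cluster_sum)
  finally show ?thesis .
qed

end

theorem theorem5p1:
  fixes n :: nat and u v :: perm
  assumes "u \<in> Sym n" and "v \<in> Sym n"
    and "bruhat_le n u v" and "u \<noteq> v"
  shows "\<exists>I \<Theta>. I \<subset> interval n u v \<and> strong_hcd n u v I \<Theta>
            \<and> Rtilde n u v = Htilde n u v I \<Theta>"
proof -
  let ?K = "{k. u k \<noteq> v k}"
  define m where "m = Max ?K"
  have sub: "?K \<subseteq> {1..n}"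
  proof
    fix k assume k: "k \<in> ?K"
    show "k \<in> {1..n}"
    proof (rule ccontr)
      assume "k \<notin> {1..n}"
      then show False using k Sym_out[OF assms(1), of k] Sym_out[OF assms(2), of k] by simp
    qed
  qed
  then have fin: "finite ?K" by (rule finite_subset) simp
  have ne: "?K \<noteq> {}" using assms(4) by auto
  have mK: "m \<in> ?K" unfolding m_def by (rule Max_in[OF fin ne])
  have "u k = v k" if "k > m" for k
    using Max_ge[OF fin, of k] that unfolding m_def by (auto simp: not_le)
  then interpret last_difference n u v m
    using assms mK sub by unfold_locales auto
  show ?thesis using I_proper strong_hcd_I Rtilde_eq_Htilde by blast
qed

end
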